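(* Let $\mathcal{A}$ be a finite-dimensional descendingly flexible algebra over an arbitrary field $\mathbb{F}$. Then $$l(\mathcal{A}) \leq \begin{cases} \left\lceil \frac{\dim \mathcal{A} - d_0}{2} \right\rceil, & 3 \leq \dim \mathcal{A} - d_0 \leq 10,\\ \lceil \log_2(\dim \mathcal{A} - d_0) + \log_2(8/3) \rceil, & 11 \leq \dim \mathcal{A} - d_0.\end{cases}$$
   Context: $\mathcal{A}$ is a finite-dimensional algebra over a field $\mathbb{F}$ (a vector space with a bilinear product), possibly non-unital and non-associative. If $\mathcal{A}$ is unital, its unity is denoted by $e$. For $S \subseteq \mathcal{A}$ and $k\ge 1$, a word of length $k$ in $S$ is any product of $k$ elements of $S$, with any arrangement of brackets. If $\mathcal{A}$ is unital, $e$ is a word of length $0$; otherwise there are no words of length $0$. $S^k$ is the set of all words in $S$ of length at most $k$. $\mathcal{L}(X)$ denotes the linear span of $X$, $\mathcal{L}_k(S) = \mathcal{L}(S^k)$ for $k\ge 0$, and $\mathcal{L}_\infty(S) = \bigcup_{k\ge 0}\mathcal{L}_k(S)$. $S$ is generating for $\mathcal{A}$ if $\mathcal{L}_\infty(S)=\mathcal{A}$. The length of $S$ is $l(S) = \min\{k : \mathcal{L}_k(S)=\mathcal{L}_\infty(S)\}$, and the length of $\mathcal{A}$ is $l(\mathcal{A}) = \max\{l(S) : \mathcal{L}_\infty(S)=\mathcal{A}\}$. Set $d_0 = 1$ if $\mathcal{A}$ is unital, and $d_0 = 0$ otherwise. For $a,b,c\in\mathcal{A}$ let $\mathcal{L}'_2(a,b,c)$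 be the span of $a,b,c,ab,ba,cb,bc,ac,ca$ (together with $e$ if $\mathcal{A}$ is unital), and let $\mathcal{L}_1(a,b,aa,ab,ba)$ be the span of $a,b,aa,ab,ba$ (together with $e$ if $\mathcal{A}$ is unital). $\mathcal{A}$ is descendingly flexible if for all $a,b,c\in\mathcal{A}$: $(ab)a,\ a(ba) \in \mathcal{L}_1(a,b,aa,ab,ba)$; $(ab)c+(cb)a\in\mathcal{L}'_2(a,b,c)$; and $a(bc)+c(ba)\in\mathcal{L}'_2(a,b,c)$. *)

theory Defs
  imports Complex_Main
begin

locale fd_algebra = vector_space scale
  for scale :: "'f::field \<Rightarrow> 'a::ab_group_add \<Rightarrow> 'a" (infixr \<open>*s\<close> 75) +
  fixes mult :: "'a \<Rightarrow> 'a \<Rightarrow> 'a" (infixl \<open>\<star>\<close> 70)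
  assumes linear_mult_right: "\<And>a. Vector_Spaces.linear (*s) (*s) (\<lambda>x. a \<star> x)"
    and linear_mult_left: "\<And>a. Vector_Spaces.linear (*s) (*s) (\<lambda>x. x \<star> a)"
    and finite_dim: "\<exists>B. finite B \<and> span B = UNIV"
begin

definition is_unity :: "'a \<Rightarrow> bool" where
  "is_unity e \<longleftrightarrow> (\<forall>x. e \<star> x = x \<and> x \<star> e = x)"

definition unital :: bool where
  "unital \<longleftrightarrow> (\<exists>e. is_unity e)"

definition d0 :: nat where
  "d0 = (if unital then 1 else 0)"

text \<open>The unity, if any, is the only word of length 0; it is a factor of longer
  words only if it lies in \<open>S\<close> or arises as a product.\<close>

inductive word :: "'a set \<Rightarrow> nat \<Rightarrow> 'a \<Rightarrow> bool" for S where
  unity: "is_unity e \<Longrightarrow> word S 0 e"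
| letter: "s \<in> S \<Longrightarrow> word S 1 s"
| product: "\<lbrakk>word S m u; word S n v; 1 \<le> m; 1 \<le> n\<rbrakk> \<Longrightarrow> word S (m + n) (u \<star> v)"

definition words_upto :: "'a set \<Rightarrow> nat \<Rightarrow> 'a set" where
  "words_upto S k = {w. \<exists>j\<le>k. word S j w}"

definition lin :: "nat \<Rightarrow> 'a set \<Rightarrow> 'a set" where
  "lin k S = span (words_upto S k)"

definition lin_inf :: "'a set \<Rightarrow> 'a set" where
  "lin_inf S = (\<Union>k. lin k S)"

definition generating :: "'a set \<Rightarrow> bool" where
  "generating S \<longleftrightarrow> lin_inf S = UNIV"

definition set_length :: "'a set \<Rightarrow> nat" where
  "set_length S = (LEAST k. lin k S = lin_inf S)"

text \<open>The maximum is over a nonempty finite set: \<open>UNIV\<close> is generating, and if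
  \<open>lin k S = lin (2 * k) S\<close> with \<open>k \<ge> 1\<close> then \<open>lin k S = lin_inf S\<close>, so that
  \<open>set_length S \<le> 2 ^ dim UNIV\<close>.\<close>

definition alg_length :: nat where
  "alg_length = Max {set_length S | S. generating S}"

definition lin2' :: "'a \<Rightarrow> 'a \<Rightarrow> 'a \<Rightarrow> 'a set" where
  "lin2' a b c = span ({a, b, c, a \<star> b, b \<star> a, c \<star> b, b \<star> c, a \<star> c, c \<star> a} \<union> {e. is_unity e})"

definition descendingly_flexible :: bool where
  "descendingly_flexible \<longleftrightarrow> (\<forall>a b c.
     (a \<star> b) \<star> a \<in> lin 1 {a, b, a \<star> a, a \<star> b, b \<star> a} \<and>
     a \<star> (b \<star> a) \<in> lin 1 {a, b, a \<star> a, a \<star> b, b \<star> a} \<and>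
     (a \<star> b) \<star> c + (c \<star> b) \<star> a \<in> lin2' a b c \<and>
     a \<star> (b \<star> c) + c \<star> (b \<star> a) \<in> lin2' a b c)"

end

end

theory Submission
  imports Defs "HOL-Library.Multiset"
begin

text \<open>
  Modulo shorter words, descending flexibility says \<open>(ab)c = - (cb)a\<close>, \<open>a(bc) = - c(ba)\<close> and
  \<open>(ab)a = a(ba) = 0\<close>. Give a letter of a bracketed word the class
  \<open>#left - #right mod 3\<close> of its path from the root; these moves preserve the class of every
  letter, and, apart from a few degenerate shapes, any letter of class \<open>1\<close> (or \<open>2\<close>) can be
  brought to the front as an outermost left (or right) factor. Hence a word with a repeated letter
  in one class reduces, and words behave like a product of three exterior algebras.

  Let \<open>w\<close> be a word of maximal length \<open>k\<close> which does not reduce. Peeling off the letters of a set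
  \<open>P\<close> writes \<open>w\<close> as a context built from \<open>P\<close> applied to a shorter word \<open>t\<^sub>P\<close> in the remaining
  letters. The context of \<open>P\<close> annihilates \<open>t\<^sub>Q\<close> for all \<open>Q \<noteq> P\<close> of the same size and the same shift of
  classes, as a letter is repeated; so these words are independent modulo shorter ones. About a
  quarter of the \<open>2 ^ k\<close> sets \<open>P\<close> can be used simultaneously, which forces
  \<open>n \<ge> 3 * 2 ^ (k - 4) + 1\<close> for \<open>k \<ge> 6\<close>, and \<open>n \<ge> 2 * k - 1\<close> for \<open>3 \<le> k \<le> 5\<close>.
\<close>

section \<open>Products of elements in spans of words\<close>

context fd_algebra
begin

lemma mult_add_right: "a \<star> (x + y) = a \<star> x + a \<star> y"
  and mult_scale_right: "a \<star> (c *s x) = c *s (a \<star> x)"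
  using linear_mult_right[of a] by (auto simp: Vector_Spaces.linear_iff)

lemma mult_add_left: "(x + y) \<star> a = x \<star> a + y \<star> a"
  and mult_scale_left: "(c *s x) \<star> a = c *s (x \<star> a)"
  using linear_mult_left[of a] by (auto simp: Vector_Spaces.linear_iff)

lemma mult_zero_right [simp]: "a \<star> 0 = 0"
  using mult_add_right[of a 0 0] by simp

lemma mult_zero_left [simp]: "0 \<star> a = 0"
  using mult_add_left[of 0 0 a] by simp

lemma mult_minus_right: "a \<star> (- x) = - (a \<star> x)"
  using mult_add_right[of a x "- x"] by (simp add: eq_neg_iff_add_eq_0 add.commute)

lemma mult_minus_left: "(- x) \<star> a = - (x \<star> a)"
  using mult_add_left[of x "- x" a] by (simp add: eq_neg_iff_add_eq_0 add.commute)

lemma subspace_lin: "subspace (lin k S)"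
  by (simp add: lin_def)

lemma lin_mono: "i \<le> j \<Longrightarrow> lin i S \<subseteq> lin j S"
  unfolding lin_def words_upto_def by (rule span_mono) (auto intro: order_trans)

lemma word_lin: "word S j w \<Longrightarrow> j \<le> k \<Longrightarrow> w \<in> lin k S"
  unfolding lin_def words_upto_def by (rule span_base) auto

lemma word_0: "word S j u \<Longrightarrow> j = 0 \<Longrightarrow> is_unity u"
  by (induction rule: word.induct) auto

text \<open>The rule \<open>product\<close> asks for positive lengths; a factor of length 0 is the
  unity and leaves the other factor unchanged.\<close>

lemma word_mult: 
  assumes "word S i u" "word S j v"
  shows "word S (i + j) (u \<star> v)"
proof -
  consider "i = 0" | "j = 0" | "1 \<le> i" "1 \<le> j" by linarith
  then show ?thesis
  proof cases
    case 1
    then have "u \<star> v = v" using word_0 assms(1) unfolding is_unity_def by blast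
    with 1 assms show ?thesis by simp
  next
    case 2
    then have "u \<star> v = u" using word_0 assms(2) unfolding is_unity_def by blast
    with 2 assms show ?thesis by simp
  next
    case 3
    then show ?thesis using assms by (blast intro: word.product)
  qed
qed

lemma mult_lin:
  assumes u: "u \<in> lin i S" and v: "v \<in> lin j S"
  shows "u \<star> v \<in> lin (i + j) S"
proof -
  have sub: "subspace {y. u \<star> y \<in> lin (i + j) S}" for u
    using subspace_lin[of "i + j" S]
    by (auto simp: subspace_def mult_add_right mult_scale_right)
  have sub': "subspace {x. x \<star> v \<in> lin (i + j) S}" for v
    using subspace_lin[of "i + j" S]
    by (auto simp: subspace_def mult_add_left mult_scale_left)
  have 1: "u \<star> y \<in> lin (i + j) S" if "u \<in> words_upto S i" "y \<in> words_upto S j" for u y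
  proof -
    from that obtain i' j' where "word S i' u" "word S j' y" "i' \<le> i" "j' \<le> j"
      by (auto simp: words_upto_def)
    then show ?thesis by (intro word_lin[OF word_mult]) auto
  qed
  have 2: "u \<star> v \<in> lin (i + j) S" if "u \<in> words_upto S i" for u
    using v span_minimal[OF _ sub, of "words_upto S j" u] 1[OF that] unfolding lin_def by blast
  show ?thesis
    using u span_minimal[OF _ sub', of "words_upto S i" v] 2 unfolding lin_def by blast
qed

lemma unity_lin: "is_unity e \<Longrightarrow> e \<in> lin k S"
  by (rule word_lin[OF word.unity]) auto

definition bmult :: "bool \<Rightarrow> 'a \<Rightarrow> 'a \<Rightarrow> 'a" where
  "bmult b x y = (if b then x \<star> y else y \<star> x)"

lemma bmult_lin: "u \<in> lin i S \<Longrightarrow> v \<in> lin j S \<Longrightarrow> bmult b u v \<in> lin (i + j) S"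
  by (auto simp: bmult_def mult_lin) (metis add.commute mult_lin)

lemma bmult_add: "bmult b u (x + y) = bmult b u x + bmult b u y"
  and bmult_scale: "bmult b u (c *s x) = c *s bmult b u x"
  and bmult_minus: "bmult b u (- x) = - bmult b u x"
  and bmult_not: "bmult (\<not> b) x y = bmult b y x"
  by (auto simp: bmult_def mult_add_left mult_add_right mult_scale_left mult_scale_right
      mult_minus_left mult_minus_right)

lemma bmult_diff: "bmult b u (x - y) = bmult b u x - bmult b u y"
  using bmult_add[of b u x "- y"] by (simp add: bmult_minus)

end

sublocale fd_algebra \<subseteq> finite_dimensional_vector_space scale
  "SOME B. finite B \<and> independent B \<and> span B = UNIV"
proof -
  obtain B where B: "finite B" "span B = UNIV" using finite_dim by blast
  obtain B' where "B' \<subseteq> B" "independent B'" "span B' = UNIV"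
    using maximal_independent_subset[of B] B(2)
    by (metis span_mono span_span top.extremum_uniqueI)
  then have "\<exists>B. finite B \<and> independent B \<and> span B = UNIV"
    using B(1) finite_subset by blast
  from someI_ex[OF this] show "finite_dimensional_vector_space scale
      (SOME B. finite B \<and> independent B \<and> span B = UNIV)"
    by unfold_locales auto
qed

section \<open>Descending flexibility on spans of words\<close>

locale flexible_algebra = fd_algebra scale mult
  for scale :: "'f::field \<Rightarrow> 'a::ab_group_add \<Rightarrow> 'a" (infixr \<open>*s\<close> 75)
    and mult :: "'a \<Rightarrow> 'a \<Rightarrow> 'a" (infixl \<open>\<star>\<close> 70) +
  fixes S :: "'a set"
  assumes flexible: "descendingly_flexible"
begin

text \<open>Apart from the unity, each generator omits at least one of the three factors, and every
  factor has degree at least 1.\<close>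

lemma lin2'_subset:
  assumes "x \<in> lin i S" "y \<in> lin j S" "z \<in> lin m S" "1 \<le> i" "1 \<le> j" "1 \<le> m"
  shows "lin2' x y z \<subseteq> lin (i + j + m - 1) S"
  unfolding lin2'_def
proof (rule span_minimal[OF _ subspace_lin])
  have p: "p \<star> q \<in> lin (i + j + m - 1) S"
    if "p \<in> lin a S" "q \<in> lin b S" "a + b \<le> i + j + m - 1" for p q a b
    using mult_lin[OF that(1,2)] lin_mono[OF that(3)] by blast
  have l: "p \<in> lin (i + j + m - 1) S"
    if "p \<in> lin a S" "a \<le> i + j + m - 1" for p a
    using that lin_mono[OF that(2)] by blast
  show "{x, y, z, x \<star> y, y \<star> x, z \<star> y, y \<star> z, x \<star> z, z \<star> x} \<union> {e. is_unity e}
      \<subseteq> lin (i + j + m - 1) S"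
    using l[OF assms(1)] l[OF assms(2)] l[OF assms(3)]
      p[OF assms(1,2)] p[OF assms(2,1)] p[OF assms(3,2)] p[OF assms(2,3)] p[OF assms(1,3)]
      p[OF assms(3,1)] assms(4-6) unity_lin by auto
qed

text \<open>\<open>b\<close> selects one of the two mirrored sum conditions. Elements of spans are
  allowed in place of letters so that whole subwords can be moved.\<close>

lemma bmult_move:
  assumes "x \<in> lin i S" "y \<in> lin j S" "z \<in> lin m S" "1 \<le> i" "1 \<le> j" "1 \<le> m"
  shows "bmult b x (bmult b y z) + bmult b z (bmult b y x) \<in> lin (i + j + m - 1) S"
proof -
  have "(z \<star> y) \<star> x + (x \<star> y) \<star> z \<in> lin2' z y x" "x \<star> (y \<star> z) + z \<star> (y \<star> x) \<in> lin2' x y z"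
    using flexible unfolding descendingly_flexible_def by blast+
  moreover have "lin2' z y x \<subseteq> lin (i + j + m - 1) S" 
    using lin2'_subset[OF assms(3,2,1,6,5,4)] by (simp add: algebra_simps)
  moreover note lin2'_subset[OF assms]
  ultimately show ?thesis by (auto simp: bmult_def)
qed

lemma bmult_repeat:
  assumes "x \<in> lin i S" "y \<in> lin j S" "1 \<le> i" "1 \<le> j"
  shows "bmult b x (bmult (\<not> b) x y) \<in> lin (i + i + j - 1) S"
proof -
  let ?X = "{x, y, x \<star> x, x \<star> y, y \<star> x}"
  have X: "?X \<subseteq> lin (i + i + j - 1) S"
  proof -
    have p: "p \<star> q \<in> lin (i + i + j - 1) S"
      if "p \<in> lin a S" "q \<in> lin b S" "a + b \<le> i + i + j - 1" for p q a b
      using mult_lin[OF that(1,2)] lin_mono[OF that(3)] by blast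
    have l: "p \<in> lin (i + i + j - 1) S"
      if "p \<in> lin a S" "a \<le> i + i + j - 1" for p a
      using that lin_mono[OF that(2)] by blast
    show ?thesis
      using l[OF assms(1)] l[OF assms(2)] p[OF assms(1,1)] p[OF assms(1,2)] p[OF assms(2,1)] assms(3,4)
      by auto
  qed
  have w: "word T n w \<Longrightarrow> n \<le> 1 \<Longrightarrow> is_unity w \<or> w \<in> T" for T n w
    by (induction rule: word.induct) auto
  have "lin 1 ?X \<subseteq> lin (i + i + j - 1) S"
    unfolding lin_def[of 1]
    by (rule span_minimal[OF _ subspace_lin])
      (use X in \<open>auto simp: words_upto_def dest!: w intro: unity_lin\<close>)
  moreover have "(x \<star> y) \<star> x \<in> lin 1 ?X" "x \<star> (y \<star> x) \<in> lin 1 ?X"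
    using flexible unfolding descendingly_flexible_def by blast+
  ultimately show ?thesis by (auto simp: bmult_def)
qed

end

section \<open>Bracketed words and the classes of their letters\<close>

datatype 'l tree = Leaf 'l | Node "'l tree" "'l tree"

text \<open>All statements come in a left and a right version, exchanged by passing to the opposite
  algebra; a Boolean selects the version. In \<open>bmult\<close> and \<open>join\<close>, \<open>True\<close> puts the first argument
  on the left.\<close>

definition join :: "bool \<Rightarrow> 'l tree \<Rightarrow> 'l tree \<Rightarrow> 'l tree" where
  "join b u v = (if b then Node u v else Node v u)"

lemma join_not: "join (\<not> b) u v = join b v u"
  by (simp add: join_def)

text \<open>The classes \<open>0, 1, 2\<close> modulo \<open>3\<close> are encoded as \<open>None\<close>, \<open>Some True\<close>, \<open>Some False\<close>.\<close>

fun shift :: "bool option \<Rightarrow> (bool option \<Rightarrow> 'l multiset) \<Rightarrow> bool option \<Rightarrow> 'l multiset" where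
  "shift None F j = F j"
| "shift (Some b) F None = F (Some (\<not> b))"
| "shift (Some b) F (Some c) = (if c = b then F None else F (Some b))"

text \<open>Addition of \<open>Some b\<close> modulo 3: \<open>shift (Some b)\<close> carries class
  \<open>k\<close> to class \<open>plus3 b k\<close>.\<close>

fun plus3 :: "bool \<Rightarrow> bool option \<Rightarrow> bool option" where
  "plus3 b None = Some b"
| "plus3 b (Some c) = (if c = b then Some (\<not> b) else None)"

lemma shift_add:
  "shift (Some b) (\<lambda>i. F i + G i) j = shift (Some b) F j + shift (Some b) G j"
  by (cases j) auto

lemma shift_shift: "shift (Some b) (shift k F) = shift (plus3 b k) F"
proof
  show "shift (Some b) (shift k F) j = shift (plus3 b k) F j" for j
    by (cases k; cases j) auto
qed

lemma mem_shift: "x \<in># shift (Some b) F i \<Longrightarrow> \<exists>k. x \<in># F k \<and> i = plus3 b k"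
proof (cases i)
  case (Some c)
  assume "x \<in># shift (Some b) F i"
  with Some show ?thesis
    by (intro exI[of _ "if c = b then None else Some b"]) (auto split: if_splits)
next
  case None
  assume "x \<in># shift (Some b) F i"
  with None show ?thesis by (intro exI[of _ "Some (\<not> b)"]) auto
qed

text \<open>Only the multiset of letters in each class is recorded: the moves preserve it, while
  they change the bracketing.\<close>

primrec cls :: "'l tree \<Rightarrow> bool option \<Rightarrow> 'l multiset" where
  "cls (Leaf x) = (\<lambda>j. if j = None then {#x#} else {#})"
| "cls (Node u v) = (\<lambda>j. shift (Some True) (cls u) j + shift (Some False) (cls v) j)"

lemma cls_join: "cls (join b u v) j = shift (Some b) (cls u) j + shift (Some (\<not> b)) (cls v) j"
  by (cases b) (auto simp: join_def)

lemma cls_join_simps [simp]: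
  "cls (join b u v) None = cls u (Some (\<not> b)) + cls v (Some b)"
  "cls (join b u v) (Some b) = cls u None + cls v (Some (\<not> b))"
  "cls (join b u v) (Some (\<not> b)) = cls u (Some b) + cls v None"
  "cls (join (\<not> b) u v) (Some b) = cls u (Some (\<not> b)) + cls v None"
  by (cases b; simp add: cls_join)+

text \<open>Computed from the classes, so that equal \<open>cls\<close> gives equally many letters;
  \<open>ok\<close> and \<open>lettered\<close> are phrased through \<open>cls\<close> for the same
  reason.\<close>

definition nleaves :: "'l tree \<Rightarrow> nat" where
  "nleaves t = size (cls t None) + size (cls t (Some True)) + size (cls t (Some False))"

lemma nleaves_Leaf [simp]: "nleaves (Leaf x) = 1"
  by (simp add: nleaves_def)

lemma nleaves_Node [simp]: "nleaves (Node u v) = nleaves u + nleaves v"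
  by (simp add: nleaves_def)

lemma nleaves_join [simp]: "nleaves (join b u v) = nleaves u + nleaves v"
  by (simp add: join_def)

lemma nleaves_alt:
  "nleaves t = size (cls t None) + size (cls t (Some b)) + size (cls t (Some (\<not> b)))"
  by (cases b) (simp_all add: nleaves_def)

lemma nleaves_pos: "0 < nleaves t"
  by (induction t) auto

text \<open>In a product, class \<open>None\<close> collects one side class of each factor, while a
  side class collects a side class of one factor and class \<open>None\<close> of the other. So
  class \<open>None\<close> keeps the parity opposite to that of both side classes.\<close>

lemma cls_parity:
  "even (size (cls t (Some True))) \<longleftrightarrow> even (size (cls t (Some False)))"
  "even (size (cls t None)) \<longleftrightarrow> odd (size (cls t (Some True)))"
  by (induction t) auto

text \<open>In a product the left factor would have no letter of class \<open>None\<close> and none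
  of class \<open>Some True\<close>, contrary to parity.\<close>

lemma sides_empty:
  assumes "cls t (Some b) = {#}" "cls t (Some (\<not> b)) = {#}"
  obtains x where "t = Leaf x"
proof (cases t)
  case (Node u v)
  with assms have "cls u None = {#}" "cls u (Some True) = {#}"
    by (cases b; simp)+
  with cls_parity(2)[of u] show ?thesis by simp
qed (rule that)

text \<open>The letter of class \<open>Some b\<close> cannot be brought to the front here: the remaining word would
  consist of at least two letters, all of class \<open>None\<close> in it, and there is no such word.\<close>

definition blocked :: "bool \<Rightarrow> 'l tree \<Rightarrow> bool" where
  "blocked b t \<longleftrightarrow> cls t None = {#} \<and> size (cls t (Some b)) = 1 \<and> 2 \<le> size (cls t (Some (\<not> b)))"

section \<open>Words up to sign and shorter words\<close>

context flexible_algebra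
begin

text \<open>A label is a pair of an element and a degree: by \<open>ok\<close> below, the element lies in the span
  of the words of length up to the degree. Letters have degree \<open>1\<close>; larger degrees arise when
  a subword is contracted to a leaf.\<close>

primrec val :: "('a \<times> nat) tree \<Rightarrow> 'a" where
  "val (Leaf x) = fst x"
| "val (Node u v) = val u \<star> val v"

primrec wt :: "('a \<times> nat) tree \<Rightarrow> nat" where
  "wt (Leaf x) = snd x"
| "wt (Node u v) = wt u + wt v"

lemma val_join [simp]: "val (join b u v) = bmult b (val u) (val v)"
  by (simp add: join_def bmult_def)

lemma wt_join [simp]: "wt (join b u v) = wt u + wt v"
  by (simp add: join_def)

definition ok :: "('a \<times> nat) tree \<Rightarrow> bool" where
  "ok t \<longleftrightarrow> (\<forall>i. \<forall>x \<in># cls t i. 1 \<le> snd x \<and> fst x \<in> lin (snd x) S)"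

lemma ok_Node: "ok (Node u v) \<longleftrightarrow> ok u \<and> ok v"
  unfolding ok_def split_option_all by (auto simp: all_bool_eq)

lemma ok_join [simp]: "ok (join b u v) \<longleftrightarrow> ok u \<and> ok v"
  by (auto simp: join_def ok_Node)

lemma ok_Leaf: "ok (Leaf x) \<longleftrightarrow> 1 \<le> snd x \<and> fst x \<in> lin (snd x) S"
  by (auto simp: ok_def)

lemma wt_pos: "ok t \<Longrightarrow> 1 \<le> wt t"
  by (induction t) (auto simp: ok_Node ok_Leaf)

lemma val_lin: "ok t \<Longrightarrow> val t \<in> lin (wt t) S"
  by (induction t) (auto simp: ok_Node ok_Leaf mult_lin)

lemma ok_leaf_of: "ok t \<Longrightarrow> x \<in># cls t i \<Longrightarrow> ok (Leaf x)"
  by (auto simp: ok_def)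

text \<open>\<open>val t \<in> low t\<close> is the precise form of "\<open>t\<close>
  reduces".\<close>

definition low :: "('a \<times> nat) tree \<Rightarrow> 'a set" where
  "low t = lin (wt t - 1) S"

lemma low_closed: "subspace (low t)"
  by (simp add: low_def subspace_lin)

lemma low_join: "x \<in> low t \<Longrightarrow> ok u \<Longrightarrow> ok t \<Longrightarrow> bmult d (val u) x \<in> low (join d u t)"
  using bmult_lin[OF val_lin, of u x "wt t - 1" d] wt_pos[of t] by (simp add: low_def)

text \<open>The sign is not tracked, because only membership in the subspace \<open>low t\<close>
  matters; equal weights make \<open>low\<close> the same on both sides.\<close>

definition sim :: "('a \<times> nat) tree \<Rightarrow> ('a \<times> nat) tree \<Rightarrow> bool" where
  "sim t t' \<longleftrightarrow> cls t = cls t' \<and> wt t = wt t' \<and> (val t - val t' \<in> low t \<or> val t + val t' \<in> low t)"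

lemma sim_cls: "sim t t' \<Longrightarrow> cls t = cls t'"
  and sim_wt: "sim t t' \<Longrightarrow> wt t = wt t'"
  and sim_ok: "sim t t' \<Longrightarrow> ok t' = ok t"
  and sim_nleaves: "sim t t' \<Longrightarrow> nleaves t = nleaves t'"
  by (auto simp: sim_def ok_def nleaves_def)

lemma sim_refl [simp]: "sim t t"
  using subspace_0[OF low_closed] by (simp add: sim_def)

lemma sim_sym: "sim t t' \<Longrightarrow> sim t' t"
  using subspace_neg[OF low_closed, of "val t - val t'" t]
  by (auto simp: sim_def low_def algebra_simps)

lemma sim_trans [trans]:
  assumes "sim t u" "sim u v"
  shows "sim t v"
proof -
  have [simp]: "low u = low t" using assms(1) by (simp add: sim_def low_def)
  have eq: "val t - val v = (val t - val u) + (val u - val v)" 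
    "val t + val v = (val t - val u) + (val u + val v)"
    "val t + val v = (val t + val u) - (val u - val v)"
    "val t - val v = (val t + val u) - (val u + val v)" by auto
  have "val t - val v \<in> low t \<or> val t + val v \<in> low t"
    using assms subspace_add[OF low_closed] subspace_diff[OF low_closed] 
    unfolding sim_def by (metis eq \<open>low u = low t\<close>)
  then show ?thesis using assms by (auto simp: sim_def)
qed

lemma sim_low: "sim t t' \<Longrightarrow> val t \<in> low t \<longleftrightarrow> val t' \<in> low t'"
proof -
  assume a: "sim t t'"
  have [simp]: "low t' = low t" using a by (simp add: sim_def low_def)
  have "val t' = (val t + val t') - val t" "val t' = val t - (val t - val t')"
    "val t = (val t + val t') - val t'" "val t = val t' + (val t - val t')" by auto
  then show ?thesis
    using a subspace_add[OF low_closed] subspace_diff[OF low_closed] 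
    unfolding sim_def by (metis \<open>low t' = low t\<close>)
qed

lemma sim_join:
  assumes "sim t t'" "ok u" "ok t"
  shows "sim (join d u t) (join d u t')"
proof -
  have "cls (join d u t) = cls (join d u t')"
    using sim_cls[OF assms(1)] by (intro ext) (simp add: cls_join)
  then show ?thesis
    using assms(1) low_join[OF _ assms(2,3), of _ d]
    by (auto simp: sim_def simp flip: bmult_diff bmult_add)
qed

text \<open>\<open>x\<close> has shift d, and \<open>z\<close> has shift -2d, which equals d modulo
  3: the classes are taken modulo 3 so that this exchange preserves them.\<close>

lemma sim_move:
  assumes "ok x" "ok y" "ok z"
  shows "sim (join d x (join d y z)) (join d z (join d y x))"
proof -
  have "cls (join d x (join d y z)) j = cls (join d z (join d y x)) j" for j
    by (cases j; cases d) (auto simp: cls_join)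
  then show ?thesis
    using bmult_move[OF val_lin val_lin val_lin wt_pos wt_pos wt_pos, OF assms assms, of d]
    by (auto simp: sim_def low_def fun_eq_iff add_ac)
qed

text \<open>The same exchange with the inner product read from the other side: neighbouring factors
  on alternating sides anticommute.\<close>

lemma sim_swap:
  assumes "ok x" "ok y" "ok z"
  shows "sim (join d x (join (\<not> d) y z)) (join d y (join (\<not> d) x z))"
  using sim_move[OF assms(1,3,2)] by (simp add: join_not)

text \<open>The same exchange with the outer product read from the other side: two factors on one
  side fuse into one factor on the opposite side.\<close>

lemma sim_fold:
  assumes "ok x" "ok y" "ok z"
  shows "sim (join d x (join d y z)) (join (\<not> d) (join d y x) z)"
  using sim_move[OF assms] by (simp add: join_not)

text \<open>If the outer factor is itself a product, \<open>sim_move\<close> exchanges one half of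
  it with the other outer factor. That half becomes the new outer factor, and induction on it ends
  at a letter.\<close>

lemma comb_form:
  assumes "ok t" "\<And>x. t \<noteq> Leaf x"
  obtains d a t' where "sim t (join d (Leaf a) t')"
proof -
  have "\<exists>d a t'. sim (join e u v) (join d (Leaf a) t')" if "ok u" "ok v" for u v e
    using that
  proof (induction u arbitrary: v e)
    case (Leaf x)
    then show ?case using sim_refl by blast
  next
    case (Node p q)
    define x y where "x = (if e then p else q)" and "y = (if e then q else p)"
    have ok: "ok x" "ok y" "ok v" using Node.prems by (auto simp: ok_Node x_def y_def)
    have "join e (Node p q) v = join (\<not> e) v (join (\<not> e) y x)"
      by (auto simp: join_def x_def y_def)
    then have "sim (join e (Node p q) v) (join (\<not> e) x (join (\<not> e) y v))"
      using sim_move[OF ok(3,2,1)] by simp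
    moreover have "\<exists>d a t'. sim (join (\<not> e) x (join (\<not> e) y v)) (join d (Leaf a) t')"
      using Node.IH ok by (cases e) (simp_all add: x_def)
    ultimately show ?case using sim_trans by blast
  qed
  moreover obtain u v where "t = join True u v"
    using assms(2) by (cases t) (auto simp: join_def)
  ultimately show thesis using assms(1) that by fastforce
qed

text \<open>Contracting a subtree to a single leaf keeps value and weight; the subtree can be
  reinserted later at any leaf carrying the same label in the same class.\<close>

definition lab :: "('a \<times> nat) tree \<Rightarrow> 'a \<times> nat" where
  "lab t = (val t, wt t)"

lemma ok_lab: "ok t \<Longrightarrow> ok (Leaf (lab t))"
  using wt_pos[of t] by (simp add: ok_Leaf lab_def val_lin)

text \<open>\<open>G\<close> holds the classes of all letters other than the replaced leaf; it is
  common to both words, so their classes can be compared.\<close>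

lemma expand:
  assumes "lab z \<in># cls t i"
  shows "\<exists>t' G. val t' = val t \<and> wt t' = wt t \<and>
    (\<forall>j. cls t j = G j + shift i (cls (Leaf (lab z))) j) \<and> (\<forall>j. cls t' j = G j + shift i (cls z) j)"
  using assms
proof (induction t arbitrary: i)
  case (Leaf x)
  then have "i = None" "x = lab z" by (auto split: if_splits)
  then show ?case by (intro exI[of _ z] exI[of _ "\<lambda>_. {#}"]) (auto simp: lab_def)
next
  case (Node u v)
  consider k where "lab z \<in># cls u k" "i = plus3 True k" | k where "lab z \<in># cls v k" "i = plus3 False k"
    using Node.prems mem_shift by fastforce
  then show ?case
  proof cases
    case 1
    from Node.IH(1)[OF 1(1)] obtain t' G where *: "val t' = val u" "wt t' = wt u"
      "cls u = (\<lambda>j. G j + shift k (cls (Leaf (lab z))) j)" "cls t' = (\<lambda>j. G j + shift k (cls z) j)"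
      by blast
    then show ?thesis
      by (intro exI[of _ "Node t' v"] exI[of _ "\<lambda>j. shift (Some True) G j + shift (Some False) (cls v) j"])
        (simp add: shift_add shift_shift 1(2) add_ac del: cls.simps(1))
  next
    case 2
    from Node.IH(2)[OF 2(1)] obtain t' G where *: "val t' = val v" "wt t' = wt v"
      "cls v = (\<lambda>j. G j + shift k (cls (Leaf (lab z))) j)" "cls t' = (\<lambda>j. G j + shift k (cls z) j)"
      by blast
    then show ?thesis
      by (intro exI[of _ "Node u t'"] exI[of _ "\<lambda>j. shift (Some False) G j + shift (Some True) (cls u) j"])
        (simp add: shift_add shift_shift 2(2) add_ac del: cls.simps(1))
  qed
qed

text \<open>Undoes a contraction after \<open>x\<close> was brought to the front. The assumption on
  \<open>x\<close> ensures that the contracted label is still available in \<open>s\<close> even if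
  it equals \<open>x\<close>.\<close>

lemma contract:
  assumes sim: "sim (join d (Leaf (lab C)) t) (join b (Leaf x) s)"
    and x: "d = b \<Longrightarrow> x \<in># cls t (Some (\<not> b))"
  shows "\<exists>s'. sim (join d C t) (join b (Leaf x) s')"
proof -
  \<comment> \<open>The class in \<open>s\<close> that becomes \<open>Some d\<close> in the whole
    word.\<close>
  define i where "i = (if d = b then Some (\<not> b) else None)"
  have i: "plus3 (\<not> b) i = Some d" by (auto simp: i_def)
  note eq = sim_cls[OF sim]
  have "lab C \<in># cls s i"
  proof (cases "d = b")
    case True
    from fun_cong[OF eq, of "Some b"] True
    have "add_mset (lab C) (cls t (Some (\<not> b))) = add_mset x (cls s (Some (\<not> b)))" by simp
    then have "lab C = x \<and> cls t (Some (\<not> b)) = cls s (Some (\<not> b)) \<or> lab C \<in># cls s (Some (\<not> b))"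
      by (metis add_eq_conv_ex union_single_eq_member)
    with x[OF True] show ?thesis using True by (auto simp: i_def)
  next
    case False
    then have d: "d = (\<not> b)" by auto
    from fun_cong[OF eq, of "Some (\<not> b)"] have "lab C \<in># cls s None"
      unfolding d by (metis cls_join_simps(2,3) add.left_neutral cls.simps(1) option.distinct(1) union_iff
          union_single_eq_member multi_member_this union_commute)
    with False show ?thesis by (simp add: i_def)
  qed
  from expand[OF this] obtain s' G where s': "val s' = val s" "wt s' = wt s"
      "cls s = (\<lambda>j. G j + shift i (cls (Leaf (lab C))) j)" "cls s' = (\<lambda>j. G j + shift i (cls C) j)"
    by blast
  have "cls (join d C t) j = cls (join b (Leaf x) s') j" for j
    using fun_cong[OF eq, of j]
    by (simp add: cls_join s'(3,4) shift_add shift_shift i add_ac del: cls.simps(1))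
  then have "sim (join d C t) (join b (Leaf x) s')"
    using sim s'(1,2) by (auto simp: sim_def lab_def low_def)
  then show ?thesis by blast
qed

section \<open>Bringing a letter to the front\<close>

abbreviation graft :: "bool \<Rightarrow> 'a \<times> nat \<Rightarrow> ('a \<times> nat) tree \<Rightarrow> ('a \<times> nat) tree" where
  "graft d a t \<equiv> join d (Leaf a) t"

lemma sim_ok_parts: "sim t (graft d a t') \<Longrightarrow> ok t \<Longrightarrow> ok (Leaf a) \<and> ok t'"
  by (metis ok_join sim_ok)

lemma size_pos_mem: "1 \<le> size M \<Longrightarrow> \<exists>x. x \<in># M"
  by (cases M) auto

lemma blocked_other:
  assumes "blocked b t" shows "\<exists>y. y \<in># cls t (Some (\<not> b)) \<and> \<not> blocked (\<not> b) t"
  using assms size_pos_mem[of "cls t (Some (\<not> b))"] by (auto simp: blocked_def)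

text \<open>Where the induction hypothesis does not apply to a subword because it is blocked, three
  letters are contracted to a single label and the hypothesis is applied to the contracted word.\<close>

lemma move_to_front:
  assumes "ok t" "x \<in># cls t (Some b)" "\<not> blocked b t"
  shows "\<exists>t'. sim t (graft b x t')"
  using assms
proof (induction "nleaves t" arbitrary: t x b rule: less_induct)
  case less
  have okx: "ok (Leaf x)" using ok_leaf_of[OF less.prems(1,2)] .
  have IH: "\<exists>s'. sim s (graft c y s')"
    if "sim t r" "nleaves s < nleaves r" "ok s" "y \<in># cls s (Some c)" "\<not> blocked c s" for s r y c
    using less.hyps[OF _ that(3-5)] that(1,2) sim_nleaves by metis
  obtain d a t1 where t1: "sim t (graft d a t1)"
    using comb_form[OF less.prems(1)] less.prems(2) by (metis cls.simps(1) empty_iff option.distinct(1) set_mset_empty)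
  have ok1: "ok (Leaf a)" "ok t1" using sim_ok_parts[OF t1 less.prems(1)] by auto
  note c1 = fun_cong[OF sim_cls[OF t1]]
  consider (same) "d = b" | (diff) "d = (\<not> b)" by auto
  then show ?case
  proof cases
    case same
    show ?thesis
    proof (cases "a = x")
      case True
      with t1 same show ?thesis by blast
    next
      case False
      then have x1: "x \<in># cls t1 (Some (\<not> b))" using less.prems(2) c1[of "Some b"] same by simp
      show ?thesis
      proof (cases "blocked (\<not> b) t1")
        case False
        then obtain t2 where t2: "sim t1 (graft (\<not> b) x t2)"
          using IH[OF t1 _ ok1(2) x1 False] by auto
        have "ok t2" using sim_ok_parts[OF t2 ok1(2)] by blast
        have "sim t (graft b a (graft (\<not> b) x t2))"
          using t1 sim_join[OF t2 ok1(1,2)] same sim_trans by blast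
        also have "sim \<dots> (graft b x (graft (\<not> b) a t2))"
          by (rule sim_swap) (use ok1 okx \<open>ok t2\<close> in auto)
        finally show ?thesis by blast
      next
        case True
        \<comment> \<open>Here \<open>x\<close> is the only letter of its class in
          \<open>t1\<close>, and class \<open>None\<close> is empty. Two letters \<open>c\<close>
          and \<open>c'\<close> are peeled instead and folded with \<open>a\<close> into one
          factor.\<close>
        from blocked_other[OF this] obtain c where c: "c \<in># cls t1 (Some b)" "\<not> blocked b t1" by auto
        then obtain t3 where t3: "sim t1 (graft b c t3)"
          using IH[OF t1 _ ok1(2) c] by auto
        have ok3: "ok (Leaf c)" "ok t3" using sim_ok_parts[OF t3 ok1(2)] by auto
        note c3 = fun_cong[OF sim_cls[OF t3]]
        from True c3[of None] c3[of "Some b"] c3[of "Some (\<not> b)"] x1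
        have m3: "cls t3 (Some b) = {#}" "x \<in># cls t3 None" "1 \<le> size (cls t3 (Some (\<not> b)))"
          by (auto simp: blocked_def)
        then obtain c' where c': "c' \<in># cls t3 (Some (\<not> b))" "\<not> blocked (\<not> b) t3"
          using size_pos_mem[of "cls t3 (Some (\<not> b))"] by (auto simp: blocked_def)
        have s3: "sim t (graft b a (graft b c t3))"
          using t1 sim_join[OF t3 ok1(1,2)] same sim_trans by blast
        obtain t4 where t4: "sim t3 (graft (\<not> b) c' t4)"
          using IH[OF s3 _ ok3(2) c'] by auto
        have ok4: "ok (Leaf c')" "ok t4" using sim_ok_parts[OF t4 ok3(2)] by auto
        note c4 = fun_cong[OF sim_cls[OF t4]]
        from m3 c4[of None] c4[of "Some b"] have m4: "x \<in># cls t4 (Some (\<not> b))" by auto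
        let ?C = "join (\<not> b) (Leaf c') (graft b c (Leaf a))"
        have "sim t (join (\<not> b) (graft b c (Leaf a)) t3)"
          using s3 by (rule sim_trans) (rule sim_fold, use ok1 ok3 in auto)
        also have "sim \<dots> (join (\<not> b) (graft b c (Leaf a)) (graft (\<not> b) c' t4))"
          by (rule sim_join[OF t4]) (use ok1 ok3 in auto)
        also have "sim \<dots> (join (\<not> \<not> b) ?C t4)"
          by (rule sim_fold) (use ok1 ok3 ok4 in auto)
        finally have sC: "sim t (join b ?C t4)" by simp
        let ?s = "graft b (lab ?C) t4"
        have "ok ?s" using ok1 ok3 ok4 ok_lab[of ?C] by simp
        \<comment> \<open>Both the contracted label and \<open>x\<close> have class
          \<open>Some b\<close>, so this class is too large for a blocked word.\<close>
        moreover have "x \<in># cls ?s (Some b)" "\<not> blocked b ?s"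
          using m4 by (auto simp: blocked_def size_eq_0_iff_empty)
        ultimately obtain s' where "sim ?s (graft b x s')"
          using IH[OF sC, of ?s x b] nleaves_pos by auto
        from contract[OF this] m4 sC show ?thesis using sim_trans by blast
      qed
    qed
  next
    case diff
    have x1: "x \<in># cls t1 None" using less.prems(2) c1[of "Some b"] diff by simp
    show ?thesis
    proof (cases "\<exists>y. t1 = Leaf y")
      case True
      then have "graft d a t1 = graft b x (Leaf a)" using x1 diff by (auto simp: join_not)
      with t1 show ?thesis by metis
    next
      case False
      then obtain e c t2 where t2: "sim t1 (graft e c t2)" using comb_form[OF ok1(2)] by blast
      have ok2: "ok (Leaf c)" "ok t2" using sim_ok_parts[OF t2 ok1(2)] by auto
      note c2 = fun_cong[OF sim_cls[OF t2]]
      have s2: "sim t (graft (\<not> b) a (graft e c t2))"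
        using t1 sim_join[OF t2 ok1(1,2)] diff sim_trans by blast
      have x2: "x \<in># cls t2 (Some e)" using x1 c2[of None] by simp
      consider (same) "e = (\<not> b)" | (diff) "e = b" by auto
      then show ?thesis
      proof cases
        case same
        let ?C = "join (\<not> b) (Leaf c) (Leaf a)"
        have okC: "ok ?C" using ok1 ok2 by auto
        have "sim t (join (\<not> \<not> b) ?C t2)"
          using s2 unfolding same
          by (rule sim_trans) (rule sim_fold, use ok1 ok2 in auto)
        then have sC: "sim t (join b ?C t2)" by simp
        show ?thesis
        proof (cases "blocked (\<not> b) t2")
          case False
          have "\<exists>t3. sim t2 (graft (\<not> b) x t3)"
            by (rule IH[OF s2 _ ok2(2) _ False]) (use x2 same in simp_all)
          then obtain t3 where t3: "sim t2 (graft (\<not> b) x t3)" by blast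
          have ok3: "ok t3" using sim_ok_parts[OF t3 ok2(2)] by auto
          from sC have "sim t (join b ?C (graft (\<not> b) x t3))"
            by (rule sim_trans) (rule sim_join[OF t3 okC ok2(2)])
          also have "sim \<dots> (graft b x (join (\<not> b) ?C t3))"
            by (rule sim_swap[OF okC okx ok3])
          finally show ?thesis by blast
        next
          case True
          from blocked_other[OF this] obtain g where g: "g \<in># cls t2 (Some b)" "\<not> blocked b t2" by auto
          then obtain t3 where t3: "sim t2 (graft b g t3)"
            using IH[OF s2 _ ok2(2) g] by auto
          have ok3: "ok (Leaf g)" "ok t3" using sim_ok_parts[OF t3 ok2(2)] by auto
          note c3 = fun_cong[OF sim_cls[OF t3]]
          let ?D = "join b (Leaf g) ?C"
          from sC have "sim t (join b ?C (graft b g t3))"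
            by (rule sim_trans) (rule sim_join[OF t3 okC ok2(2)])
          also have "sim \<dots> (join (\<not> b) ?D t3)"
            by (rule sim_fold[OF okC ok3])
          finally have sD: "sim t (join (\<not> b) ?D t3)" .
          let ?s = "graft (\<not> b) (lab ?D) t3"
          have "ok ?s" using ok3 okC ok_lab[of ?D] by simp
          \<comment> \<open>\<open>t2\<close> has at least two letters of class
            \<open>Some b\<close>; the one left after removing \<open>g\<close> has class
            \<open>None\<close> in the contracted word, which is therefore not blocked.\<close>
          moreover have "x \<in># cls ?s (Some b)" "\<not> blocked b ?s"
            using x2 True c3[of "Some b"] c3[of "Some (\<not> b)"] same by (auto simp: blocked_def size_eq_0_iff_empty)
          ultimately obtain s' where "sim ?s (graft b x s')"
            using IH[OF sD, of ?s x b] okC nleaves_pos by auto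
          from contract[OF this] sD show ?thesis using sim_trans by auto
        qed
      next
        case diff2: diff
        have m: "cls t None = cls t2 None" "cls t (Some b) = cls t2 (Some b)"
            "cls t (Some (\<not> b)) = {#a#} + {#c#} + cls t2 (Some (\<not> b))"
          using c1[of None] c1[of "Some b"] c1[of "Some (\<not> b)"] c2[of None] c2[of "Some b"] 
            c2[of "Some (\<not> b)"] diff diff2 by auto
        with less.prems(3) have n2: "\<not> blocked b t2" by (auto simp: blocked_def)
        have "\<exists>t3. sim t2 (graft b x t3)"
          by (rule IH[OF s2 _ ok2(2) _ n2]) (use x2 diff2 in simp_all)
        then obtain t3 where t3: "sim t2 (graft b x t3)" by blast
        have ok3: "ok t3" using sim_ok_parts[OF t3 ok2(2)] by auto
        \<comment> \<open>If \<open>t3\<close> were a leaf, \<open>t\<close> would have the letter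
          \<open>x\<close> of class \<open>Some b\<close>, three letters of the opposite class and
          nothing else, hence be blocked.\<close>
        have "\<nexists>y. t3 = Leaf y"
          using less.prems(3) m fun_cong[OF sim_cls[OF t3]] by (auto simp: blocked_def)
        then obtain f y t4 where t4: "sim t3 (graft f y t4)" using comb_form[OF ok3] by metis
        have ok4: "ok (Leaf y)" "ok t4" using sim_ok_parts[OF t4 ok3] by auto
        have "sim t2 (graft b x (graft f y t4))"
          using t3 sim_join[OF t4 okx ok3] sim_trans by blast
        then have "sim (graft b c t2) (graft b c (graft b x (graft f y t4)))"
          by (rule sim_join[OF _ ok2])
        then have "sim (graft (\<not> b) a (graft b c t2)) (graft (\<not> b) a (graft b c (graft b x (graft f y t4))))"
          by (rule sim_join[OF _ ok1(1)]) (use ok2 in simp)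
        then have s4: "sim t (graft (\<not> b) a (graft b c (graft b x (graft f y t4))))"
          using s2 sim_trans unfolding diff2 by blast
        \<comment> \<open>Two consecutive factors on side \<open>\<not> b\<close> above
          \<open>x\<close> are wanted: \<open>a\<close> and \<open>C\<close> then fuse into a factor
          on side \<open>b\<close>, which can be swapped with \<open>x\<close>.\<close>
        have "\<exists>C D. ok C \<and> ok D \<and> sim (graft b c (graft b x (graft f y t4))) (join (\<not> b) C (graft (\<not> b) x D))"
        proof (cases "f = b")
          case True
          have "sim (graft b c (graft b x (graft b y t4))) (join (\<not> b) (graft b x (Leaf c)) (graft b y t4))"
            by (rule sim_fold) (use ok2 okx ok4 in auto)
          also have "sim \<dots> (graft (\<not> b) y (join b (graft b x (Leaf c)) t4))"
            using sim_swap[of "graft b x (Leaf c)" "Leaf y" t4 "\<not> b"] ok2 okx ok4 by simp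
          also have "sim \<dots> (graft (\<not> b) y (graft (\<not> b) x (graft (\<not> b) c t4)))"
          proof (rule sim_join)
            have "sim (graft (\<not> b) x (graft (\<not> b) c t4)) (join (\<not> \<not> b) (graft (\<not> b) c (Leaf x)) t4)"
              by (rule sim_fold) (use ok2 okx ok4 in auto)
            then show "sim (join b (graft b x (Leaf c)) t4) (graft (\<not> b) x (graft (\<not> b) c t4))"
              by (simp add: join_not sim_sym)
          qed (use ok2 okx ok4 in auto)
          finally show ?thesis using True ok2 ok4
            by (intro exI[of _ "Leaf y"] exI[of _ "graft (\<not> b) c t4"]) auto
        next
          case False
          then have f: "f = (\<not> b)" by auto
          have "sim (graft b c (graft b x (graft (\<not> b) y t4))) (graft b c (graft b y (graft (\<not> b) x t4)))"
            by (rule sim_join[OF sim_swap]) (use ok2 okx ok4 in auto)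
          also have "sim \<dots> (join (\<not> b) (graft b y (Leaf c)) (graft (\<not> b) x t4))"
            by (rule sim_fold) (use ok2 okx ok4 in auto)
          finally show ?thesis using f ok2 ok4
            by (intro exI[of _ "graft b y (Leaf c)"] exI[of _ t4]) auto
        qed
        then obtain C D where okCD: "ok C" "ok D"
          and "sim (graft b c (graft b x (graft f y t4))) (join (\<not> b) C (graft (\<not> b) x D))" by blast
        from sim_join[OF this(3) ok1(1)] s4 ok2 okx ok4
        have "sim t (graft (\<not> b) a (join (\<not> b) C (graft (\<not> b) x D)))" using sim_trans by fastforce
        also have "sim \<dots> (join (\<not> \<not> b) (join (\<not> b) C (Leaf a)) (graft (\<not> b) x D))"
          by (rule sim_fold) (use okCD okx ok1 in auto)
        also have "sim \<dots> (join b (join (\<not> b) C (Leaf a)) (graft (\<not> b) x D))"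
          by simp
        also have "sim \<dots> (graft b x (join (\<not> b) (join (\<not> b) C (Leaf a)) D))"
          by (rule sim_swap) (use okCD okx ok1 in auto)
        finally show ?thesis by blast
      qed
    qed
  qed
qed

end

section \<open>Peeling off letters\<close>

fun alt :: "bool \<Rightarrow> 'l list \<Rightarrow> (bool \<times> 'l) list" where
  "alt d [] = []"
| "alt d (x # xs) = (d, x) # alt (\<not> d) xs"

lemma length_alt [simp]: "length (alt d xs) = length xs"
  by (induction xs arbitrary: d) auto

text \<open>The effect of a context on an arbitrary class profile \<open>F\<close>, so that the
  profile left after peeling can be prescribed before a word with it is known.\<close>

fun cls_ops :: "(bool \<times> 'l) list \<Rightarrow> (bool option \<Rightarrow> 'l multiset) \<Rightarrow> bool option \<Rightarrow> 'l multiset" where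
  "cls_ops [] F = F"
| "cls_ops ((d, a) # ps) F =
    (\<lambda>j. (if j = Some d then {#a#} else {#}) + shift (Some (\<not> d)) (cls_ops ps F) j)"

lemma shift_point:
  "shift (Some c) (\<lambda>j. if j = i then M else {#}) j = (if j = plus3 c i then M else {#})"
  by (cases i; cases j) auto

lemma shift_leaf: "shift (Some d) (cls (Leaf a)) j = (if j = Some d then {#a#} else {#})"
  by (cases j) auto

lemma shift_inj:
  assumes "\<And>j. shift (Some d) F j = shift (Some d) G j" shows "F = G"
proof -
  from assms have "shift (Some d) F = shift (Some d) G" by (simp add: fun_eq_iff)
  then have "shift (Some (\<not> d)) (shift (Some d) F) = shift (Some (\<not> d)) (shift (Some d) G)" by simp
  then show ?thesis by (simp add: shift_shift fun_eq_iff)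
qed

lemma cls_ops_append: "cls_ops (ps @ qs) F = cls_ops ps (cls_ops qs F)"
  by (induction ps) (auto split: prod.splits)

text \<open>The second letter is attached on side \<open>\<not> d\<close> and shifted once more by
  -d; since -2d equals d modulo 3, it has the class of the first. Two consecutive shifts
  cancel.\<close>

lemma cls_ops_alt:
  "cls_ops (alt d xs) F j = (if j = Some d then mset xs else {#}) +
     (if even (length xs) then F j else shift (Some (\<not> d)) F j)"
proof (induction xs arbitrary: d j)
  case (Cons x xs)
  have *: "cls_ops (alt (\<not> d) xs) F = (\<lambda>j. (if j = Some (\<not> d) then mset xs else {#}) +
     (if even (length xs) then F else shift (Some d) F) j)"
    using Cons by (simp add: fun_eq_iff)
  have "shift (Some (\<not> d)) (\<lambda>j. if j = Some (\<not> d) then mset xs else {#}) j = (if j = Some d then mset xs else {#})"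
    by (cases j) auto
  then show ?case
    by (simp add: * shift_add shift_shift)
qed simp

text \<open>By \<open>sides_empty\<close> no word has such a profile, so it cannot be left over by
  peeling.\<close>

definition stuck :: "(bool option \<Rightarrow> 'l multiset) \<Rightarrow> bool" where
  "stuck F \<longleftrightarrow> (\<forall>b. F (Some b) = {#}) \<and> 2 \<le> size (F None)"

text \<open>In this shape two letters of class \<open>Some b\<close> can never be moved next to each other; they still
  anticommute, but in characteristic \<open>2\<close> a repeated letter need not give \<open>0\<close>.\<close>

definition exceptional :: "bool \<Rightarrow> 'l tree \<Rightarrow> bool" where
  "exceptional b t \<longleftrightarrow> size (cls t (Some b)) = 2 \<and> cls t (Some (\<not> b)) = {#} \<and> 2 \<le> size (cls t None)"

section \<open>Repeated letters and peeling\<close>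

context flexible_algebra
begin

text \<open>Both copies of \<open>x\<close> are brought to the front, on alternating sides, where
  \<open>bmult_repeat\<close> applies. The second copy is blocked exactly in the exceptional
  shape.\<close>

lemma repeat_side:
  assumes "ok t" and x: "2 \<le> count (cls t (Some b)) x" and "\<not> exceptional b t"
  shows "val t \<in> low t"
proof -
  have sz: "2 \<le> size (cls t (Some b))" by (rule order_trans[OF x count_le_size])
  have "x \<in># cls t (Some b)" using x by (auto simp flip: count_greater_zero_iff)
  moreover have "\<not> blocked b t" using sz by (simp add: blocked_def)
  ultimately obtain t1 where t1: "sim t (graft b x t1)"
    using move_to_front[OF assms(1)] by blast
  note c = fun_cong[OF sim_cls[OF t1]]
  have ok1: "ok (Leaf x)" "ok t1" using sim_ok_parts[OF t1 assms(1)] by auto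
  have "x \<in># cls t1 (Some (\<not> b))"
    using x c[of "Some b"] by (auto simp flip: count_greater_zero_iff)
  moreover have "\<not> blocked (\<not> b) t1"
    using assms(3) c[of None] c[of "Some b"] c[of "Some (\<not> b)"] by (auto simp: blocked_def exceptional_def)
  ultimately obtain t2 where t2: "sim t1 (graft (\<not> b) x t2)"
    using move_to_front[OF ok1(2)] by blast
  have "ok t2" using sim_ok_parts[OF t2 ok1(2)] by auto
  have "sim t (graft b x (graft (\<not> b) x t2))"
    using t1 sim_join[OF t2 ok1] sim_trans by blast
  moreover have "val (graft b x (graft (\<not> b) x t2)) \<in> low (graft b x (graft (\<not> b) x t2))"
    using bmult_repeat[where x = "fst x" and i = "snd x" and b = b, OF _ val_lin _ wt_pos, OF _ \<open>ok t2\<close> _ \<open>ok t2\<close>] ok1(1)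
    by (simp add: low_def ok_Leaf add.assoc)
  ultimately show ?thesis using sim_low by blast
qed

lemma low_graft: "sim t (graft d a t') \<Longrightarrow> ok t \<Longrightarrow> val t' \<in> low t' \<Longrightarrow> val t \<in> low t"
  using low_join[of "val t'" t' "Leaf a" d] sim_low[of t] sim_ok_parts by auto

text \<open>Removing one outer letter turns class \<open>None\<close> into a side class. If the
  remainder is exceptional, a letter on the opposite side can be removed instead, and that remainder
  is not exceptional.\<close>

lemma repeat_mid:
  assumes "ok t" and x: "2 \<le> count (cls t None) x"
  shows "val t \<in> low t"
proof -
  have "t \<noteq> Leaf y" for y using x by (auto split: if_splits)
  then obtain d a t1 where t1: "sim t (graft d a t1)" using comb_form[OF assms(1)] by metis
  note c = fun_cong[OF sim_cls[OF t1]]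
  have ok1: "ok t1" using sim_ok_parts[OF t1 assms(1)] by auto
  show ?thesis
  proof (cases "exceptional d t1")
    case False
    have "2 \<le> count (cls t1 (Some d)) x" using x c[of None] by simp
    from low_graft[OF t1 assms(1) repeat_side[OF ok1 this False]] show ?thesis .
  next
    case True
    then have sz: "2 \<le> size (cls t (Some (\<not> d)))" 
      using c[of "Some (\<not> d)"] by (auto simp: exceptional_def)
    then obtain y where "y \<in># cls t (Some (\<not> d))"
      using size_pos_mem[of "cls t (Some (\<not> d))"] by auto
    moreover have "\<not> blocked (\<not> d) t" using sz by (simp add: blocked_def)
    ultimately obtain t2 where t2: "sim t (graft (\<not> d) y t2)"
      using move_to_front[OF assms(1)] by blast
    note c2 = fun_cong[OF sim_cls[OF t2]]
    have ok2: "ok t2" using sim_ok_parts[OF t2 assms(1)] by auto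
    have "\<not> exceptional (\<not> d) t2" using sz c2[of "Some (\<not> d)"] True c[of "Some d"] by (auto simp: exceptional_def)
    moreover have "2 \<le> count (cls t2 (Some (\<not> d))) x" using x c2[of None] by simp
    ultimately show ?thesis using low_graft[OF t2 assms(1) repeat_side[OF ok2]] by blast
  qed
qed

fun grafts :: "(bool \<times> 'a \<times> nat) list \<Rightarrow> ('a \<times> nat) tree \<Rightarrow> ('a \<times> nat) tree" where
  "grafts [] t = t"
| "grafts ((d, a) # ps) t = graft d a (grafts ps t)"

text \<open>The context as a linear map on the whole algebra, to be applied also to remainders of
  other peelings.\<close>

fun grafts_val :: "(bool \<times> 'a \<times> nat) list \<Rightarrow> 'a \<Rightarrow> 'a" where
  "grafts_val [] v = v"
| "grafts_val ((d, a) # ps) v = bmult d (fst a) (grafts_val ps v)"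

lemma cls_grafts: "cls (grafts ps t) = cls_ops ps (cls t)"
proof (induction ps t rule: grafts.induct)
  case (2 d a ps t)
  show ?case
    by (rule ext) (simp only: grafts.simps cls_ops.simps cls_join shift_leaf 2)
qed simp

lemma val_grafts: "val (grafts ps t) = grafts_val ps (val t)"
  by (induction ps t rule: grafts.induct) auto

lemma grafts_val_add: "grafts_val ps (x + y) = grafts_val ps x + grafts_val ps y"
  and grafts_val_scale: "grafts_val ps (c *s x) = c *s grafts_val ps x"
  by (induction ps) (auto simp: bmult_add bmult_scale)

text \<open>A letter is blocked only if all that remains has class \<open>None\<close> and consists
  of at least two letters. If further letters are to be peeled, the next one has a side class;
  otherwise \<open>F\<close> would be stuck.\<close>

lemma peel:
  assumes "ok t" "cls t = cls_ops ps F" "\<not> stuck F"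
  shows "\<exists>t'. sim t (grafts ps t') \<and> cls t' = F \<and> ok t'"
  using assms
proof (induction ps arbitrary: t)
  case (Cons p ps)
  obtain d a where p: "p = (d, a)" by (cases p)
  define G where "G = cls_ops ps F"
  have c: "cls t j = (if j = Some d then {#a#} else {#}) + shift (Some (\<not> d)) G j" for j
    using Cons.prems(2) by (simp add: p G_def)
  have "\<not> blocked d t"
  proof
    assume "blocked d t"
    then have G: "G (Some d) = {#}" "G (Some (\<not> d)) = {#}" "2 \<le> size (G None)"
      using c[of None] c[of "Some d"] c[of "Some (\<not> d)"] by (auto simp: blocked_def)
    then have G': "G (Some b) = {#}" for b by (cases "b = d") auto
    show False
    proof (cases ps)
      case Nil
      with G G' Cons.prems(3) show False by (auto simp: stuck_def G_def)
    next
      case (Cons q qs)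
      then show False using G'[of "fst q"] by (cases q) (auto simp: G_def)
    qed
  qed
  moreover have "a \<in># cls t (Some d)" by (simp add: c)
  ultimately obtain t1 where t1: "sim t (graft d a t1)"
    using move_to_front[OF Cons.prems(1)] by blast
  have ok1: "ok (Leaf a)" "ok t1" using sim_ok_parts[OF t1 Cons.prems(1)] by auto
  have "cls t1 = G"
    using fun_cong[OF sim_cls[OF t1]] c 
    by (intro shift_inj[of "\<not> d"]) (simp add: cls_join shift_leaf del: cls.simps(1) cls_join_simps)
  then obtain t' where t': "sim t1 (grafts ps t')" "cls t' = F" "ok t'"
    using Cons.IH[OF ok1(2)] Cons.prems(3) by (auto simp: G_def)
  have "sim t (grafts (p # ps) t')"
    using t1 sim_join[OF t'(1) ok1] sim_trans by (auto simp: p)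
  with t' show ?case by blast
next
  case Nil
  then show ?case by (intro exI[of _ t]) simp
qed

lemma grafts_val_lin:
  assumes "ok (grafts ps t)" "v \<in> low t"
  shows "grafts_val ps v \<in> low (grafts ps t)"
  using assms
proof (induction ps t rule: grafts.induct)
  case (2 d a ps t)
  then show ?case using low_join[of "grafts_val ps v" "grafts ps t" "Leaf a" d] by auto
qed simp

section \<open>Independence detected by linear maps\<close>

lemma dim_step:
  assumes "finite I" "subspace L" "U \<subseteq> W" "\<And>i. i \<in> I \<Longrightarrow> f i \<in> W"
    and add: "\<And>i x y. i \<in> I \<Longrightarrow> \<phi> i (x + y) = \<phi> i x + \<phi> i y"
    and scale: "\<And>i c x. i \<in> I \<Longrightarrow> \<phi> i (c *s x) = c *s \<phi> i x"
    and U: "\<And>i x. i \<in> I \<Longrightarrow> x \<in> U \<Longrightarrow> \<phi> i x \<in> L"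
    and diag: "\<And>i. i \<in> I \<Longrightarrow> \<phi> i (f i) \<notin> L"
    and off: "\<And>i j. i \<in> I \<Longrightarrow> j \<in> I \<Longrightarrow> i \<noteq> j \<Longrightarrow> \<phi> i (f j) \<in> L"
  shows "dim U + card I \<le> dim W"
proof -
  have "dim U + card J \<le> dim (U \<union> f ` J)" if "finite J" "J \<subseteq> I" for J
    using that
  proof (induction J)
    case (insert j J)
    \<comment> \<open>The preimage of \<open>L\<close> under the \<open>j\<close>-th map contains
      \<open>U\<close> and the earlier vectors but not \<open>f j\<close>.\<close>
    have "subspace {v. \<phi> j v \<in> L}"
      using \<open>subspace L\<close> add[of j] scale[of j] scale[of j 0 0] insert.prems
      by (auto simp: subspace_def)
    moreover have "U \<union> f ` J \<subseteq> {v. \<phi> j v \<in> L}"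
      using U off insert by blast
    ultimately have "f j \<notin> span (U \<union> f ` J)"
      using diag[of j] insert.prems span_minimal by blast
    then have "dim (insert (f j) (U \<union> f ` J)) = dim (U \<union> f ` J) + 1"
      by (simp add: dim_insert)
    then show ?case using insert by simp
  qed simp
  from this[OF \<open>finite I\<close>] have "dim U + card I \<le> dim (U \<union> f ` I)" by simp
  also have "\<dots> \<le> dim W" using assms(3,4) by (intro dim_subset) auto
  finally show ?thesis .
qed

text \<open>\<open>dim_step\<close> is applied degree by degree, with \<open>U\<close> the span one
  degree lower, so that off-diagonal vanishing is asked only within one degree.\<close>

lemma dim_count:
  assumes "finite I" and r: "\<And>i. i \<in> I \<Longrightarrow> 1 \<le> r i \<and> r i \<le> k \<and> f i \<in> lin (r i) S" and "subspace L"
    and add: "\<And>i x y. i \<in> I \<Longrightarrow> \<phi> i (x + y) = \<phi> i x + \<phi> i y"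
    and scale: "\<And>i c x. i \<in> I \<Longrightarrow> \<phi> i (c *s x) = c *s \<phi> i x"
    and U: "\<And>i x. i \<in> I \<Longrightarrow> x \<in> lin (r i - 1) S \<Longrightarrow> \<phi> i x \<in> L"
    and diag: "\<And>i. i \<in> I \<Longrightarrow> \<phi> i (f i) \<notin> L"
    and off: "\<And>i j. i \<in> I \<Longrightarrow> j \<in> I \<Longrightarrow> i \<noteq> j \<Longrightarrow> r i = r j \<Longrightarrow> \<phi> i (f j) \<in> L"
  shows "dim (lin 0 S) + card I \<le> dim (lin k S)"
proof -
  have "dim (lin 0 S) + card {i \<in> I. r i \<le> m} \<le> dim (lin m S)" for m
  proof (induction m)
    case 0
    have "{i \<in> I. r i \<le> 0} = {}" using r by force
    then have "card {i \<in> I. r i \<le> 0} = 0" by (simp only: card.empty)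
    then show ?case by simp
  next
    case (Suc m)
    let ?J = "{i \<in> I. r i = Suc m}"
    have "dim (lin m S) + card ?J \<le> dim (lin (Suc m) S)"
    proof (rule dim_step[where f = f and \<phi> = \<phi> and L = L])
      show "f i \<in> lin (Suc m) S" if "i \<in> ?J" for i using r[of i] that by auto
      show "\<phi> i x \<in> L" if "i \<in> ?J" "x \<in> lin m S" for i x using U[of i x] that by simp
      show "\<phi> i (f j) \<in> L" if "i \<in> ?J" "j \<in> ?J" "i \<noteq> j" for i j using off[of i j] that by simp
    qed (use \<open>finite I\<close> \<open>subspace L\<close> lin_mono[of m "Suc m"] add scale diag in simp_all)
    moreover have "card {i \<in> I. r i \<le> Suc m} \<le> card {i \<in> I. r i \<le> m} + card ?J"
    proof -
      have eq: "{i \<in> I. r i \<le> Suc m} = {i \<in> I. r i \<le> m} \<union> ?J" by auto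
      show ?thesis unfolding eq by (rule card_Un_le)
    qed
    ultimately show ?case using Suc by linarith
  qed
  moreover have "{i \<in> I. r i \<le> k} = I" using r by auto
  ultimately show ?thesis by metis
qed

text \<open>In the zero algebra the unity is 0 and spans nothing, hence the assumption.\<close>

lemma d0_le_dim_lin_0:
  assumes "(UNIV :: 'a set) \<noteq> {0}" shows "d0 \<le> dim (lin 0 S)"
proof (cases unital)
  case True
  then obtain e where e: "is_unity e" by (auto simp: unital_def)
  have "e \<noteq> 0"
  proof
    assume "e = 0"
    then have "x = 0" for x :: 'a using e by (metis is_unity_def mult_zero_left)
    with assms show False by auto
  qed
  then have "dim {e} = 1" by simp
  moreover have "dim {e} \<le> dim (lin 0 S)" using unity_lin[OF e] by (intro dim_subset) auto
  ultimately show ?thesis by (simp add: d0_def)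
qed (simp add: d0_def)

end

section \<open>Counting independent words\<close>

text \<open>Toggling one fixed element of \<open>N\<close> pairs the even subsets with the odd
  ones.\<close>

lemma card_parity_subsets:
  assumes "finite N" "N \<noteq> {}"
  shows "card {Y. Y \<subseteq> N \<and> even (m + card Y)} = 2 ^ (card N - 1)"
proof -
  obtain a where a: "a \<in> N" using assms(2) by blast
  let ?E = "\<lambda>m. {Y. Y \<subseteq> N \<and> even (m + card Y)}"
  define f where "f = (\<lambda>Y. if a \<in> Y then Y - {a} else insert a Y)"
  have ff: "f (f Y) = Y" for Y by (auto simp: f_def)
  have f: "f Y \<subseteq> N \<and> even (Suc m + card (f Y))" if "Y \<subseteq> N" "even (m + card Y)" for Y m
  proof -
    have fin: "finite Y" using that assms finite_subset by auto
    show ?thesis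
    proof (cases "a \<in> Y")
      case True
      then obtain Z where "Y = insert a Z" "a \<notin> Z" by (rule mk_disjoint_insert[THEN exE]) blast
      with fin that show ?thesis by (auto simp: f_def)
    next
      case False
      with fin that a show ?thesis by (auto simp: f_def)
    qed
  qed
  have "f ` ?E m \<subseteq> ?E (Suc m)" using f[of _ m] by blast
  moreover have "f ` ?E (Suc m) \<subseteq> ?E m" using f[of _ "Suc m"] by auto
  ultimately have "bij_betw f (?E m) (?E (Suc m))"
    by (intro bij_betw_byWitness[where f' = f]) (simp_all add: ff)
  then have "card (?E m) = card (?E (Suc m))" by (rule bij_betw_same_card)
  moreover have "card (?E m) + card (?E (Suc m)) = card (?E m \<union> ?E (Suc m))"
    by (rule card_Un_disjoint[symmetric]) (use assms in auto)
  moreover have "?E m \<union> ?E (Suc m) = Pow N" by auto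
  ultimately have "2 * card (?E m) = 2 ^ card N" using assms by (simp add: card_Pow)
  moreover have "card N = Suc (card N - 1)" using assms by (simp add: card_gt_0_iff)
  ultimately show ?thesis by (metis mult_cancel_left power_Suc zero_neq_numeral)
qed

lemma card_parity_pairs:
  assumes "finite A" "finite N" "N \<noteq> {}"
  shows "card {(a, Y). a \<in> A \<and> Y \<subseteq> N \<and> even (f a + card Y)} = card A * 2 ^ (card N - 1)"
proof -
  have "{(a, Y). a \<in> A \<and> Y \<subseteq> N \<and> even (f a + card Y)} = (SIGMA a:A. {Y. Y \<subseteq> N \<and> even (f a + card Y)})"
    by auto
  then show ?thesis using assms by (simp add: card_parity_subsets del: even_add)
qed

text \<open>Alternating sides consumes the letters of one class; the three classes are consumed one after
  the other, in an order depending on the parities.\<close>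

lemma cls_ops_sets:
  fixes X0 X1 X2 :: "'l set"
  assumes "finite X0" "finite X1" "finite X2" "even (card X0 + card X1)" "odd (card X1 + card X2)"
  shows "\<exists>ps. length ps = card X0 + card X1 + card X2 \<and>
    (\<forall>F j. cls_ops ps F j = mset_set (case j of None \<Rightarrow> X0 | Some c \<Rightarrow> if c = b then X1 else X2)
      + shift (Some b) F j)"
proof -
  have "\<exists>xs. mset xs = mset_set X \<and> length xs = card X" if "finite X" for X :: "'l set"
    using finite_distinct_list[OF that] by (metis distinct_card mset_set_set)
  then obtain L0 L1 L2 where L: "mset L0 = mset_set X0" "length L0 = card X0"
    "mset L1 = mset_set X1" "length L1 = card X1" "mset L2 = mset_set X2" "length L2 = card X2"
    using assms(1-3) by metis
  note simps = cls_ops_append cls_ops_alt[abs_def] L shift_add shift_shift shift_point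
  show ?thesis
  proof (cases "even (card X1)")
    case True
    \<comment> \<open>Starting sides compensate the accumulated shift: the odd list
      \<open>L2\<close> leaves shift \<open>b\<close>, so \<open>L0\<close> starts on side
      \<open>\<not> b\<close> to get class \<open>None\<close>.\<close>
    show ?thesis
      by (rule exI[of _ "alt b L1 @ alt (\<not> b) L2 @ alt (\<not> b) L0"])
        (use True assms(4,5) in \<open>auto simp: simps split: option.splits\<close>)
  next
    case False
    \<comment> \<open>The odd list \<open>L1\<close> leaves shift \<open>\<not> b\<close>, and the
      odd list \<open>L0\<close> changes it to \<open>b\<close>, so that \<open>L2\<close> gets
      class \<open>\<not> b\<close>.\<close>
    show ?thesis
      by (rule exI[of _ "alt b L1 @ alt b L0 @ alt b L2"])
        (use False assms(4,5) in \<open>auto simp: simps split: option.splits\<close>)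
  qed
qed

section \<open>Families of remainders of a word that does not reduce\<close>

context flexible_algebra
begin

text \<open>Excludes contracted labels, so that the weight is the number of letters.\<close>

definition lettered :: "('a \<times> nat) tree \<Rightarrow> bool" where
  "lettered t \<longleftrightarrow> (\<forall>i. \<forall>x \<in># cls t i. snd x = 1)"

lemma lettered_Node: "lettered (Node u v) \<longleftrightarrow> lettered u \<and> lettered v"
  unfolding lettered_def split_option_all by (auto simp: all_bool_eq)

lemma lettered_join: "lettered (join b u v) \<longleftrightarrow> lettered u \<and> lettered v"
  by (auto simp: join_def lettered_Node)

lemma lettered_Leaf: "lettered (Leaf x) \<longleftrightarrow> snd x = 1"
  by (auto simp: lettered_def)

lemma lettered_wt: "lettered t \<Longrightarrow> wt t = nleaves t"
  by (induction t) (auto simp: lettered_Node lettered_Leaf)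

lemma lettered_sim: "sim t t' \<Longrightarrow> lettered t' = lettered t"
  by (auto simp: sim_def lettered_def)

lemma lettered_grafts: "lettered (grafts ps t) \<longleftrightarrow> (\<forall>p \<in> set ps. lettered (Leaf (snd p))) \<and> lettered t"
  by (induction ps t rule: grafts.induct) (auto simp: lettered_join)

lemma ok_grafts: "ok (grafts ps t) \<longleftrightarrow> (\<forall>p \<in> set ps. ok (Leaf (snd p))) \<and> ok t"
  by (induction ps t rule: grafts.induct) auto

lemma nleaves_grafts: "nleaves (grafts ps t) = length ps + nleaves t"
  by (induction ps t rule: grafts.induct) auto

definition essential :: "('a \<times> nat) tree \<Rightarrow> bool" where
  "essential t \<longleftrightarrow> ok t \<and> lettered t \<and> val t \<notin> low t"

lemma essential_sim: "sim t t' \<Longrightarrow> essential t' = essential t"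
  using lettered_sim sim_ok sim_low by (auto simp: essential_def)

lemma essential_dim:
  assumes "essential t" shows "dim (lin (nleaves t - 1) S) + 1 \<le> dim (lin (nleaves t) S)"
proof -
  have v: "val t \<in> lin (nleaves t) S" "val t \<notin> lin (nleaves t - 1) S"
    using assms val_lin[of t] by (auto simp: essential_def lettered_wt low_def)
  then have "dim (insert (val t) (lin (nleaves t - 1) S)) = dim (lin (nleaves t - 1) S) + 1"
    using subspace_lin[of "nleaves t - 1" S] by (simp add: dim_insert span_eq_iff[THEN iffD2])
  then show ?thesis
    using v lin_mono[of "nleaves t - 1" "nleaves t" S] dim_subset[of "insert (val t) (lin (nleaves t - 1) S)" "lin (nleaves t) S"]
    by auto
qed

text \<open>The context \<open>ps i\<close> sends its own remainder to \<open>t0\<close> up to sign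
  and shorter words, and by \<open>off\<close> sends the other remainders of the same length to
  shorter words. Nonempty contexts make the remainders shorter than \<open>t0\<close>, whose own
  value gives the final 1.\<close>

lemma family:
  assumes ess: "essential t0" and "finite I"
    and ps: "\<And>i. i \<in> I \<Longrightarrow> cls t0 = cls_ops (ps i) (F i) \<and> \<not> stuck (F i) \<and> ps i \<noteq> []"
    and off: "\<And>i j t. i \<in> I \<Longrightarrow> j \<in> I \<Longrightarrow> i \<noteq> j \<Longrightarrow> length (ps i) = length (ps j) \<Longrightarrow> ok t \<Longrightarrow>
      nleaves t = nleaves t0 \<Longrightarrow> cls t = cls_ops (ps i) (F j) \<Longrightarrow> val t \<in> low t"
  shows "dim (lin 0 S) + card I + 1 \<le> dim (lin (nleaves t0) S)"
proof -
  have t0: "ok t0" "lettered t0" "val t0 \<notin> low t0" using ess by (auto simp: essential_def)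
  have "\<exists>t'. sim t0 (grafts (ps i) t') \<and> cls t' = F i \<and> ok t'" if "i \<in> I" for i
    using peel[OF t0(1)] ps[OF that] by blast
  then obtain T where T: "\<And>i. i \<in> I \<Longrightarrow> sim t0 (grafts (ps i) (T i)) \<and> cls (T i) = F i \<and> ok (T i)"
    by metis
  have oks: "ok (grafts (ps i) (T i))" "lettered (grafts (ps i) (T i))" 
     "nleaves (T i) + length (ps i) = nleaves t0" if "i \<in> I" for i
    using T[OF that] sim_ok lettered_sim t0 sim_nleaves nleaves_grafts by fastforce+
  have U: "lettered (T i)" if "i \<in> I" for i
    using oks(2)[OF that] by (simp add: lettered_grafts)
  let ?r = "\<lambda>i. nleaves (T i)"
  have "dim (lin 0 S) + card I \<le> dim (lin (nleaves t0 - 1) S)"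
  proof (rule dim_count[where r = ?r and f = "\<lambda>i. val (T i)" and \<phi> = "\<lambda>i. grafts_val (ps i)" and L = "low t0"])
    fix i assume i: "i \<in> I"
    show "1 \<le> ?r i \<and> ?r i \<le> nleaves t0 - 1 \<and> val (T i) \<in> lin (?r i) S"
      using oks(3)[OF i] nleaves_pos[of "T i"] ps[OF i] T[OF i] val_lin[of "T i"] lettered_wt[OF U[OF i]]
      by (cases "ps i") auto
    show "grafts_val (ps i) (val (T i)) \<notin> low t0"
      using sim_low[of t0 "grafts (ps i) (T i)"] T[OF i] t0(3) sim_wt by (fastforce simp: val_grafts low_def)
    show "grafts_val (ps i) x \<in> low t0" if "x \<in> lin (?r i - 1) S" for x
      using grafts_val_lin[OF oks(1)[OF i], of x] that lettered_wt[OF U[OF i]] sim_wt[of t0 "grafts (ps i) (T i)"] T[OF i] by (simp add: low_def)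
    fix j assume j: "j \<in> I" "i \<noteq> j" "?r i = ?r j"
    let ?t = "grafts (ps i) (T j)"
    have ok: "ok ?t" using oks(1)[OF i] oks(1)[OF j(1)] by (simp add: ok_grafts)
    have "lettered ?t" using oks(2)[OF i] oks(2)[OF j(1)] by (simp add: lettered_grafts)
    moreover have n: "nleaves ?t = nleaves t0" using oks(3)[OF i] j(3) by (simp add: nleaves_grafts)
    ultimately have "low ?t = low t0" using lettered_wt t0(2) by (simp add: low_def)
    moreover have "val ?t \<in> low ?t"
      using off[OF i j(1,2) _ ok n] oks(3)[OF i] oks(3)[OF j(1)] j(3) T[OF j(1)] by (simp add: cls_grafts)
    ultimately show "grafts_val (ps i) (val (T j)) \<in> low t0" by (simp add: val_grafts)
  qed (use \<open>finite I\<close> low_closed grafts_val_add grafts_val_scale in auto)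
  with essential_dim[OF ess] show ?thesis by linarith
qed

lemma no_repeat_mset_set: "(\<And>x. \<not> 2 \<le> count M x) \<Longrightarrow> mset_set (set_mset M) = M"
proof (rule multiset_eqI)
  fix x assume *: "\<And>x. \<not> 2 \<le> count M x"
  show "count (mset_set (set_mset M)) x = count M x"
  proof (cases "x \<in># M")
    case True
    then have "0 < count M x" by simp
    with *[of x] have "count M x = 1" by linarith
    with True show ?thesis by (simp add: count_mset_set)
  next
    case False
    then show ?thesis by (simp add: count_mset_set not_in_iff)
  qed
qed

lemma essential_mid: "essential t \<Longrightarrow> mset_set (set_mset (cls t None)) = cls t None"
  by (rule no_repeat_mset_set) (auto simp: essential_def dest: repeat_mid)

lemma essential_side:
  "essential t \<Longrightarrow> \<not> exceptional b t \<Longrightarrow> mset_set (set_mset (cls t (Some b))) = cls t (Some b)"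
  by (rule no_repeat_mset_set) (auto simp: essential_def dest: repeat_side)

text \<open>Only subsets of class \<open>None\<close> are peeled off here, since this case contains the exceptional
  shapes. All sizes occur, but each size with a single shift of classes.\<close>

lemma bound_two_sides:
  assumes ess: "essential t" and two: "size (cls t (Some True)) + size (cls t (Some False)) = 2"
  shows "dim (lin 0 S) + 2 ^ (nleaves t - 2) + 1 \<le> dim (lin (nleaves t) S)"
proof -
  obtain e where e: "1 \<le> size (cls t (Some e))"
    using two by (metis add_is_0 le_numeral_extra(4) less_one not_less zero_neq_numeral)
  then obtain x where x: "x \<in># cls t (Some e)" using size_pos_mem by blast
  have sz: "size (cls t (Some e)) + size (cls t (Some (\<not> e))) = 2" using two by (cases e) auto
  define N where "N = set_mset (cls t None)"
  have N: "mset_set N = cls t None" "finite N" using essential_mid[OF ess] by (auto simp: N_def)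
  then have card_N: "card N = nleaves t - 2"
    using two nleaves_def[of t] by (metis add.assoc add_diff_cancel_right' size_mset_set)
  define xs where "xs P = (SOME l. mset l = mset_set P)" for P :: "('a \<times> nat) set"
  have xs: "mset (xs P) = mset_set P" for P
    using someI_ex[OF ex_mset[of "mset_set P"]] by (simp add: xs_def)
  then have len: "length (xs P) = card P" for P by (metis size_mset size_mset_set)
  \<comment> \<open>The side letter \<open>x\<close> comes first and shifts by
    \<open>\<not> e\<close>, so that the alternating letters after it have class
    \<open>None\<close>.\<close>
  define ps where "ps P = (e, x) # alt e (xs P)" for P
  define R where "R P = (\<lambda>j. cls t j - (if j = Some e then {#x#} else {#}) -
    (if j = None then mset_set P else {#}))" for P
  define F where "F P = (if even (card P) then shift (Some e) (R P) else shift (Some (\<not> e)) (R P))" for P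
  have c: "cls_ops (ps P) G j = (if j = Some e then {#x#} else {#}) + (if j = None then mset_set P else {#})
      + (if even (card P) then shift (Some (\<not> e)) G j else shift (Some e) G j)" for P G j
    by (simp add: ps_def cls_ops_alt[abs_def] len xs shift_add shift_point shift_shift)
  have cF: "cls_ops (ps P) (F Q) j = (if j = Some e then {#x#} else {#}) + (if j = None then mset_set P else {#})
     + R Q j" if "card P = card Q" for P Q j
    using that by (auto simp: c F_def shift_shift)
  have "dim (lin 0 S) + card (Pow N) + 1 \<le> dim (lin (nleaves t) S)"
  proof (rule family[OF ess, where ps = ps and F = F])
    fix P assume "P \<in> Pow N"
    then have "mset_set P \<subseteq># cls t None"
      using N subset_imp_msubset_mset_set[of P N] by auto
    then have "cls t j = cls_ops (ps P) (F P) j" for j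
      using x by (cases j) (auto simp: cF R_def)
    \<comment> \<open>Only side letters can end up in class \<open>None\<close> of the remainder,
      all from the same side class, and \<open>x\<close> has been removed: at most one is
      left.\<close>
    moreover have "size (F P None) \<le> 1"
      using e sz x by (auto simp: F_def R_def size_Diff_singleton)
    ultimately show "cls t = cls_ops (ps P) (F P) \<and> \<not> stuck (F P) \<and> ps P \<noteq> []"
      by (auto simp: stuck_def ps_def)
  next
    fix P Q u
    assume PQ: "P \<in> Pow N" "Q \<in> Pow N" "P \<noteq> Q" "length (ps P) = length (ps Q)" and "ok u"
      and u: "cls u = cls_ops (ps P) (F Q)"
    have "card P = card Q" using PQ(4) by (simp add: ps_def len)
    moreover have fin: "finite P" "finite Q" using PQ N finite_subset by auto
    ultimately obtain y where y: "y \<in> P" "y \<notin> Q" using PQ(3) card_subset_eq by blast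
    have "count (cls u None) y = 2"
      using y fin PQ(1) N(2) \<open>card P = card Q\<close> by (auto simp: u cF R_def simp flip: N(1))
    then show "val u \<in> low u" using repeat_mid[OF \<open>ok u\<close>, of y] by simp
  qed (use N in simp)
  then show ?thesis by (simp add: card_Pow N card_N)
qed

text \<open>The subtracted power of two bounds the number of sets whose complement consists of two or
  more letters of a single class, and is therefore not the set of letters of a word.\<close>

lemma bound_many_sides:
  assumes ess: "essential t" and le: "size (cls t (Some b)) \<le> size (cls t (Some (\<not> b)))"
    and three: "3 \<le> size (cls t (Some b)) + size (cls t (Some (\<not> b)))"
  shows "dim (lin 0 S) + 2 ^ (nleaves t - 2) + 1 \<le> 
    dim (lin (nleaves t) S) + (if size (cls t (Some b)) \<le> 2 then 0 else 2 ^ (size (cls t (Some b)) - 1))"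
proof -
  define N where "N j = set_mset (cls t j)" for j
  have "\<not> exceptional c t" for c using three by (cases "c = b") (auto simp: exceptional_def)
  then have N: "mset_set (N j) = cls t j" for j
    using essential_mid[OF ess] essential_side[OF ess] by (cases j) (auto simp: N_def)
  have fin: "finite (N j)" for j by (simp add: N_def)
  have card_N: "card (N j) = size (cls t j)" for j by (metis N size_mset_set)
  define n0 n1 n2 where "n0 = card (N None)" and "n1 = card (N (Some b))" and "n2 = card (N (Some (\<not> b)))"
  have n: "nleaves t = n0 + n1 + n2" "n1 \<le> n2" "3 \<le> n1 + n2"
    using nleaves_alt[of t b] le three by (simp_all add: n0_def n1_def n2_def card_N)
  have par: "even n0 \<longleftrightarrow> odd n1"
    using cls_parity[of t] by (cases b) (auto simp: n0_def n1_def card_N)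
  define X where "X = (\<lambda>((X0, X1), X2) j. case j of None \<Rightarrow> X0 | Some c \<Rightarrow> if c = b then X1 else (X2 :: ('a \<times> nat) set))"
  \<comment> \<open>The parities in \<open>E\<close> and \<open>T\<close> are those of
    \<open>cls_ops_sets\<close>: every context shifts by \<open>b\<close>, and a quarter of all
    choices qualifies.\<close>
  define E where "E = {(X0, X1). X0 \<subseteq> N None \<and> X1 \<subseteq> N (Some b) \<and> even (card X0 + card X1)}"
  define T where "T = {(p, X2). p \<in> E \<and> X2 \<subseteq> N (Some (\<not> b)) \<and> even (Suc (card (snd p)) + card X2)}"
  \<comment> \<open>Undoing the shift moves class \<open>Some b\<close> to \<open>None\<close>, so a
    remainder is stuck when it consists of two or more letters of class
    \<open>Some b\<close>.\<close>
  define B where "B = (\<lambda>X1. ((N None, X1), N (Some (\<not> b)))) `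
    {X1. X1 \<subseteq> N (Some b) \<and> even (n0 + card X1) \<and> 2 \<le> card (N (Some b) - X1)}"
  \<comment> \<open>Toggling needs a nonempty set: class \<open>None\<close>, or if that is empty,
    class \<open>Some b\<close>, which is then odd by parity.\<close>
  have cardE: "card E = 2 ^ (n0 + n1 - 1)"
  proof (cases "n0 = 0")
    case False
    then have ne: "N None \<noteq> {}" by (auto simp: n0_def)
    have "E = prod.swap ` {(X1, X0). X1 \<in> Pow (N (Some b)) \<and> X0 \<subseteq> N None \<and> even (card X1 + card X0)}"
      by (auto simp: E_def image_iff add.commute)
    then have "card E = card {(X1, X0). X1 \<in> Pow (N (Some b)) \<and> X0 \<subseteq> N None \<and> even (card X1 + card X0)}"
      by (simp only:) (rule card_image, auto intro: inj_onI)
    also have "\<dots> = card (Pow (N (Some b))) * 2 ^ (card (N None) - 1)"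
      by (rule card_parity_pairs) (use fin ne in auto)
    finally show ?thesis using False fin
      by (simp add: card_Pow flip: power_add n0_def n1_def)
  next
    case True
    then have ne: "N (Some b) \<noteq> {}" using par by (auto simp: n1_def)
    have "E = {(X0, X1). X0 \<in> Pow (N None) \<and> X1 \<subseteq> N (Some b) \<and> even (card X0 + card X1)}"
      by (auto simp: E_def)
    then have "card E = card (Pow (N None)) * 2 ^ (card (N (Some b)) - 1)"
      using card_parity_pairs[of "Pow (N None)" "N (Some b)" card] fin ne by simp
    then show ?thesis using True fin by (simp add: card_Pow flip: n0_def n1_def)
  qed
  have finE: "finite E"
    by (rule finite_subset[of _ "Pow (N None) \<times> Pow (N (Some b))"]) (use fin in \<open>auto simp: E_def\<close>)
  have finT: "finite T"
    by (rule finite_subset[of _ "E \<times> Pow (N (Some (\<not> b)))"]) (use fin finE in \<open>auto simp: T_def\<close>)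
  have "card T = card E * 2 ^ (card (N (Some (\<not> b))) - 1)"
    unfolding T_def by (rule card_parity_pairs) (use fin finE n in \<open>auto simp: n2_def\<close>)
  moreover have "n0 + n1 - 1 + (n2 - 1) = nleaves t - 2" using n par odd_pos[of n1] by (cases "n0 = 0") auto
  ultimately have cardT: "card T = 2 ^ (nleaves t - 2)"
    by (simp add: cardE flip: n2_def power_add)
  have cardB: "card B \<le> (if n1 \<le> 2 then 0 else 2 ^ (n1 - 1))"
  proof -
    let ?Y = "{X1. X1 \<subseteq> N (Some b) \<and> even (n0 + card X1)}"
    let ?Z = "{X1. X1 \<subseteq> N (Some b) \<and> even (n0 + card X1) \<and> 2 \<le> card (N (Some b) - X1)}"
    have B_le: "card B \<le> card ?Z"
      unfolding B_def by (rule card_image_le) (use fin in auto)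
    show ?thesis
    proof (cases "n1 \<le> 2")
      case True
      \<comment> \<open>This would need \<open>n1 = 2\<close> and \<open>X1\<close> empty, but then
        \<open>n0\<close> is odd and the parity condition fails.\<close>
      have "\<not> 2 \<le> card (N (Some b) - X1)" if X1: "X1 \<subseteq> N (Some b)" "even (n0 + card X1)" for X1
      proof
        assume "2 \<le> card (N (Some b) - X1)"
        moreover have "card (N (Some b) - X1) = n1 - card X1"
          unfolding n1_def by (rule card_Diff_subset[OF finite_subset[OF X1(1) fin] X1(1)])
        ultimately have "n1 = 2" "card X1 = 0" using True by linarith+
        with X1(2) par show False by simp
      qed
      then have Z: "?Z = {}" by (intro equals0I) blast
      from B_le[unfolded Z] True show ?thesis by simp
    next
      case False
      then have "N (Some b) \<noteq> {}" by (auto simp: n1_def)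
      from card_parity_subsets[OF fin this, of n0] have "card ?Y = 2 ^ (n1 - 1)" by (simp add: n1_def)
      moreover have "card ?Z \<le> card ?Y" by (rule card_mono) (use fin in auto)
      ultimately show ?thesis using False B_le by simp
    qed
  qed
  have XN: "X i j \<subseteq> N j" and finX: "finite (X i j)" if "i \<in> T" for i j
  proof -
    show "X i j \<subseteq> N j" using that by (auto simp: T_def E_def X_def split: option.splits if_splits; (cases b; auto)?)
    then show "finite (X i j)" using fin finite_subset by blast
  qed
  define tot where "tot i = card (X i None) + card (X i (Some b)) + card (X i (Some (\<not> b)))" for i
  have "\<exists>ps. length ps = tot i \<and> (\<forall>F j. cls_ops ps F j = mset_set (X i j) + shift (Some b) F j)"
    if "i \<in> T" for i
  proof -
    obtain X0 X1 X2 where i: "i = ((X0, X1), X2)" by (cases i) auto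
    have "finite X0" "finite X1" "finite X2"
      using finX[OF that, of None] finX[OF that, of "Some b"] finX[OF that, of "Some (\<not> b)"] by (auto simp: X_def i)
    moreover have "even (card X0 + card X1)" "odd (card X1 + card X2)" using that by (auto simp: i T_def E_def)
    ultimately show ?thesis using cls_ops_sets[of X0 X1 X2 b] by (simp add: X_def i tot_def)
  qed
  then obtain ps where ps: "\<And>i. i \<in> T \<Longrightarrow> length (ps i) = tot i"
     "\<And>i F j. i \<in> T \<Longrightarrow> cls_ops (ps i) F j = mset_set (X i j) + shift (Some b) F j" by metis
  define F where "F i = shift (Some (\<not> b)) (\<lambda>j. cls t j - mset_set (X i j))" for i
  have cF: "cls_ops (ps i) (F i') j = mset_set (X i j) + (cls t j - mset_set (X i' j))" if "i \<in> T" for i i' j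
    using that by (simp add: ps F_def shift_shift)
  have sub: "mset_set (X i j) \<subseteq># cls t j" if "i \<in> T" for i j
    using subset_imp_msubset_mset_set[OF XN[OF that] fin, of j] by (simp add: N)
  have "dim (lin 0 S) + card (T - B) + 1 \<le> dim (lin (nleaves t) S)"
  proof (rule family[OF ess, where ps = ps and F = F])
    fix i assume "i \<in> T - B"
    then have i: "i \<in> T" "i \<notin> B" by auto
    obtain X0 X1 X2 where X': "i = ((X0, X1), X2)" by (cases i) auto
    have ev: "even (card X0 + card X1)" "odd (card X1 + card X2)" using i by (auto simp: X' T_def E_def)
    have "cls t = cls_ops (ps i) (F i)"
      using sub[OF i(1)] by (intro ext) (simp add: cF[OF i(1)])
    moreover have "\<not> stuck (F i)"
    proof
      assume st: "stuck (F i)"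
      have z: "X i j = N j" if "cls t j - mset_set (X i j) = {#}" for j
        using that sub[OF i(1), of j] finX[OF i(1), of j]
        by (metis N N_def Diff_eq_empty_iff_mset finite_set_mset_mset_set subset_mset.antisym)
      from st have "F i (Some b) = {#}" "F i (Some (\<not> b)) = {#}" "2 \<le> size (F i None)"
        by (auto simp: stuck_def)
      then have "X i (Some (\<not> b)) = N (Some (\<not> b))" "X i None = N None"
        and s: "2 \<le> size (cls t (Some b) - mset_set (X i (Some b)))"
        using z[of None] z[of "Some (\<not> b)"] by (auto simp: F_def)
      then have "X0 = N None" "X2 = N (Some (\<not> b))" by (auto simp: X_def X')
      moreover have "size (cls t (Some b) - mset_set (X i (Some b))) = card (N (Some b) - X1)"
        using XN[OF i(1), of "Some b"] finX[OF i(1), of "Some b"] sub[OF i(1), of "Some b"]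
        by (simp add: size_Diff_submset X_def X' card_Diff_subset card_N)
      ultimately have "i \<in> B" using s XN[OF i(1), of "Some b"] ev by (auto simp: B_def X' X_def n0_def)
      with i(2) show False by simp
    qed
    moreover have "ps i \<noteq> []"
    proof
      assume "ps i = []"
      then have "tot i = 0" using ps(1)[OF i(1)] by simp
      then show False using ev by (auto simp: tot_def X' X_def)
    qed
    ultimately show "cls t = cls_ops (ps i) (F i) \<and> \<not> stuck (F i) \<and> ps i \<noteq> []" by blast
  next
    fix i i' u
    assume ii: "i \<in> T - B" "i' \<in> T - B" "i \<noteq> i'" "length (ps i) = length (ps i')" and "ok u"
      and nl: "nleaves u = nleaves t" and u: "cls u = cls_ops (ps i) (F i')"
    have T: "i \<in> T" "i' \<in> T" using ii by auto
    have tot: "tot i = tot i'" using ii(4) ps(1) T by simp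
    have dup: "count (cls u j) y = 2" if "y \<in> X i j" "y \<notin> X i' j" for y j
      using that XN[OF T(1), of j] finX[OF T(1), of j] finX[OF T(2), of j] fin[of j] 
      by (auto simp: u cF[OF T(1)] simp flip: N)
    show "val u \<in> low u"
    proof (cases "X i None \<subseteq> X i' None")
      case False
      then obtain y where "y \<in> X i None" "y \<notin> X i' None" by blast
      from dup[OF this] show ?thesis using repeat_mid[OF \<open>ok u\<close>, of y] by simp
    next
      case True
      have "\<exists>c. \<not> X i (Some c) \<subseteq> X i' (Some c)"
      proof (rule ccontr)
        assume "\<not> ?thesis"
        with True have le: "X i j \<subseteq> X i' j" for j by (cases j) auto
        have "card (X i j) \<le> card (X i' j)" for j by (rule card_mono[OF finX[OF T(2)] le])
        from this[of None] this[of "Some b"] this[of "Some (\<not> b)"] tot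
        have "card (X i None) = card (X i' None)" "card (X i (Some b)) = card (X i' (Some b))"
          "card (X i (Some (\<not> b))) = card (X i' (Some (\<not> b)))" by (auto simp: tot_def)
        then have "X i None = X i' None" "X i (Some b) = X i' (Some b)" "X i (Some (\<not> b)) = X i' (Some (\<not> b))"
          using card_subset_eq[OF finX[OF T(2)] le] by auto
        with ii(3) show False by (cases i; cases i') (auto simp: X_def)
      qed
      then obtain c y where y: "y \<in> X i (Some c)" "y \<notin> X i' (Some c)" by blast
      \<comment> \<open>An exceptional word has all but two letters in class \<open>None\<close>;
        here at most \<open>n0\<close> letters are in that class, and
        \<open>n1 + n2 \<ge> 3\<close>.\<close>
      have "\<not> exceptional c u"
      proof
        assume "exceptional c u"
        then have "nleaves u = size (cls u None) + 2" 
          using nleaves_alt[of u c] by (simp add: exceptional_def)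
        moreover have "size (cls u None) \<le> n0"
        proof -
          have "size (cls u None) = card (X i None) + (n0 - card (X i' None))"
            unfolding u cF[OF T(1)] size_union size_Diff_submset[OF sub[OF T(2)]] n0_def card_N by simp
          moreover have "card (X i None) \<le> card (X i' None)" by (rule card_mono[OF finX[OF T(2)] True])
          moreover have "card (X i' None) \<le> n0" unfolding n0_def by (rule card_mono[OF fin XN[OF T(2)]])
          ultimately show ?thesis by simp
        qed
        ultimately show False using nl n by simp
      qed
      from repeat_side[OF \<open>ok u\<close> _ this, of y] dup[OF y] show ?thesis by simp
    qed
  qed (use finT in simp)
  moreover have "card T - card B \<le> card (T - B)"
    by (rule diff_card_le_card_Diff) (use fin in \<open>simp add: B_def\<close>)
  ultimately show ?thesis using cardT cardB by (simp add: card_N n1_def split: if_splits)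
qed

section \<open>Short words and the general dimension bound\<close>

lemma bmult_add_left: "bmult b (x + y) u = bmult b x u + bmult b y u"
  and bmult_scale_left: "bmult b (c *s x) u = c *s bmult b x u"
  using bmult_add[of "\<not> b" u] bmult_scale[of "\<not> b" u] by (simp_all add: bmult_not)

text \<open>Modulo shorter words, \<open>p\<close> and \<open>q\<close> anticommute here and a
  repetition vanishes. So multiplying by \<open>p\<close> and by \<open>q\<close> separates the two
  shorter products, and likewise \<open>p\<close> and \<open>q\<close> themselves.\<close>

lemma essential_pair:
  assumes ess: "essential t0" and sim: "sim t0 (grafts ps (graft d p (graft (\<not> d) q t)))"
  shows "dim (lin (nleaves t) S) + 2 \<le> dim (lin (Suc (nleaves t)) S)"
    and "dim (lin 0 S) + 2 \<le> dim (lin 1 S)"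
proof -
  let ?pq = "graft d p (graft (\<not> d) q t)" and ?qp = "graft d q (graft (\<not> d) p t)"
  have t0: "ok t0" "lettered t0" "val t0 \<notin> low t0" using ess by (auto simp: essential_def)
  from sim t0 have *: "ok (grafts ps ?pq)" "lettered (grafts ps ?pq)" using sim_ok lettered_sim by blast+
  then have ok: "ok (Leaf p)" "ok (Leaf q)" "ok t" and un: "snd p = 1" "snd q = 1" "lettered t"
    by (auto simp: ok_grafts lettered_grafts lettered_join lettered_Leaf)
  have ok': "ok (grafts ps (graft d x (graft (\<not> d) y t)))" if "x \<in> {p, q}" "y \<in> {p, q}" for x y
    using * ok that by (auto simp: ok_grafts)
  have low0: "low (grafts ps (graft d x (graft (\<not> d) y t))) = low t0" if "x \<in> {p, q}" "y \<in> {p, q}" for x y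
  proof -
    have "lettered (grafts ps (graft d x (graft (\<not> d) y t)))"
      using * un that by (auto simp: lettered_grafts lettered_join lettered_Leaf)
    then show ?thesis using sim_nleaves[OF sim] t0(2) by (simp add: low_def lettered_wt nleaves_grafts)
  qed
  have low1: "low (graft d x (graft (\<not> d) y t)) = lin (Suc (nleaves t)) S" if "x \<in> {p, q}" "y \<in> {p, q}" for x y
    using that un lettered_wt[OF un(3)] by (auto simp: low_def)
  have ins: "grafts_val ps v \<in> low t0" if "v \<in> lin (Suc (nleaves t)) S" for v
    using grafts_val_lin[OF ok'[of p q], of v] low0[of p q] low1[of p q] that by simp
  have P: "grafts_val ps (bmult d (fst p) (bmult (\<not> d) (fst q) (val t))) \<notin> low t0"
    using sim_low[OF sim] t0(3) low0[of p q] by (simp add: val_grafts)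
  have Q: "grafts_val ps (bmult d (fst q) (bmult (\<not> d) (fst p) (val t))) \<notin> low t0"
  proof -
    have "bmult d (fst p) (bmult (\<not> d) (fst q) (val t)) + bmult d (fst q) (bmult (\<not> d) (fst p) (val t))
        \<in> lin (Suc (nleaves t)) S"
      using bmult_move[of "fst p" 1 "val t" "wt t" "fst q" 1 d] ok val_lin[of t] wt_pos[of t] un lettered_wt[OF un(3)]
      by (simp add: ok_Leaf bmult_not)
    from ins[OF this] have "grafts_val ps (bmult d (fst p) (bmult (\<not> d) (fst q) (val t)))
        + grafts_val ps (bmult d (fst q) (bmult (\<not> d) (fst p) (val t))) \<in> low t0"
      by (simp add: grafts_val_add)
    with P show ?thesis
      using subspace_diff[OF low_closed] by (metis add_diff_cancel_right')
  qed
  have rep: "grafts_val ps (bmult d (fst x) (bmult (\<not> d) (fst x) (val t))) \<in> low t0" if "x \<in> {p, q}" for x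
    using bmult_repeat[of "fst x" 1 "val t" "wt t" d] ok un that val_lin[of t] wt_pos[of t] lettered_wt[OF un(3)] 
    by (intro ins) (auto simp: ok_Leaf)
  define a b where "a c = (if c then p else q)" and "b c = (if c then q else p)" for c
  have ab: "a c \<in> {p, q}" "b c \<in> {p, q}" "c \<noteq> c' \<Longrightarrow> b c' = a c" for c c'
    by (auto simp: a_def b_def)
  have diag: "grafts_val ps (bmult d (fst (a c)) (bmult (\<not> d) (fst (b c)) (val t))) \<notin> low t0" for c
    using P Q by (simp add: a_def b_def)
  have snds: "snd (a c) = 1" "snd (b c) = 1" "fst (a c) \<in> lin 1 S" "fst (b c) \<in> lin 1 S" for c
    using un ok by (auto simp: a_def b_def ok_Leaf)
  have t1: "val t \<in> lin (nleaves t) S" using val_lin[OF ok(3)] lettered_wt[OF un(3)] by simp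
  have "dim (lin (nleaves t) S) + card (UNIV :: bool set) \<le> dim (lin (Suc (nleaves t)) S)"
  proof (rule dim_step[where f = "\<lambda>c. bmult (\<not> d) (fst (b c)) (val t)" and L = "low t0"
        and \<phi> = "\<lambda>c v. grafts_val ps (bmult d (fst (a c)) v)"])
    show "bmult (\<not> d) (fst (b c)) (val t) \<in> lin (Suc (nleaves t)) S" for c
      using bmult_lin[OF snds(4) t1] by simp
    show "grafts_val ps (bmult d (fst (a c)) v) \<in> low t0" if "v \<in> lin (nleaves t) S" for c v
      using ins bmult_lin[OF snds(3) that] by simp
    show "grafts_val ps (bmult d (fst (a c)) (bmult (\<not> d) (fst (b c')) (val t))) \<in> low t0" if "c \<noteq> c'" for c c'
      using rep[OF ab(1)[of c]] ab(3)[OF that] by simp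
  qed (use diag low_closed lin_mono[of "nleaves t" "Suc (nleaves t)" S] in \<open>auto simp: bmult_add bmult_scale grafts_val_add grafts_val_scale\<close>)
  then show "dim (lin (nleaves t) S) + 2 \<le> dim (lin (Suc (nleaves t)) S)" by simp
  have "dim (lin 0 S) + card (UNIV :: bool set) \<le> dim (lin 1 S)"
  proof (rule dim_step[where f = "\<lambda>c. fst (a c)" and L = "low t0"
        and \<phi> = "\<lambda>c v. grafts_val ps (bmult d v (bmult (\<not> d) (fst (b c)) (val t)))"])
    show "grafts_val ps (bmult d v (bmult (\<not> d) (fst (b c)) (val t))) \<in> low t0" if "v \<in> lin 0 S" for c v
      using ins bmult_lin[OF that bmult_lin[OF snds(4) t1]] by simp
    show "grafts_val ps (bmult d (fst (a c')) (bmult (\<not> d) (fst (b c)) (val t))) \<in> low t0" if "c \<noteq> c'" for c c'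
      using rep[OF ab(1)[of c']] ab(3)[of c' c] that by simp
  qed (use diag low_closed snds lin_mono[of 0 1 S] in \<open>auto simp: bmult_add_left bmult_scale_left grafts_val_add grafts_val_scale\<close>)
  then show "dim (lin 0 S) + 2 \<le> dim (lin 1 S)" by simp
qed

lemma comb_form_sized:
  assumes "ok t" "2 \<le> nleaves t"
  obtains d a t' where "sim t (graft d a t')" "ok (Leaf a)" "ok t'" "nleaves t = Suc (nleaves t')"
proof -
  have "t \<noteq> Leaf x" for x using assms(2) by auto
  from comb_form[OF assms(1) this] obtain d a t' where "sim t (graft d a t')" by blast
  moreover from this have "nleaves t = Suc (nleaves t')" using sim_nleaves by fastforce
  ultimately show thesis using that sim_ok_parts[OF _ assms(1)] by blast
qed

lemma nleaves_eq_1: "nleaves t = 1 \<Longrightarrow> \<exists>x. t = Leaf x"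
proof (cases t)
  case (Node u v)
  then show "nleaves t = 1 \<Longrightarrow> ?thesis" using nleaves_pos[of u] nleaves_pos[of v] by simp
qed simp

text \<open>With two letters the side is free: either letter may count as the outer one.\<close>

lemma comb_form_2:
  assumes "ok t" "nleaves t = 2"
  obtains a z where "sim t (graft d a (Leaf z))" "ok (Leaf a)" "ok (Leaf z)"
proof -
  obtain e a t' where t: "sim t (graft e a t')" "ok (Leaf a)" "ok t'" "nleaves t = Suc (nleaves t')"
    using comb_form_sized assms by (metis order_refl)
  then obtain z where z: "t' = Leaf z" using assms(2) nleaves_eq_1[of t'] by auto
  show thesis
  proof (cases "e = d")
    case False
    then have "graft e a (Leaf z) = graft d z (Leaf a)" by (auto simp: join_def)
    with t z that show ?thesis by metis
  qed (use t z that in blast)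
qed

text \<open>Degrees 1, 2 and 3 contribute 2, 2 and 1 dimensions.\<close>

lemma bound_3:
  assumes ess: "essential t" and "nleaves t = 3"
  shows "dim (lin 0 S) + 5 \<le> dim (lin 3 S)"
proof -
  have ok: "ok t" using ess by (simp add: essential_def)
  have "2 \<le> nleaves t" using assms(2) by simp
  then obtain d a t1 where t1: "sim t (graft d a t1)" "ok (Leaf a)" "ok t1" "nleaves t = Suc (nleaves t1)"
    using comb_form_sized[OF ok] by blast
  then have "nleaves t1 = 2" using assms(2) by simp
  then obtain c z where t2: "sim t1 (graft (\<not> d) c (Leaf z))" using comb_form_2[OF t1(3)] by metis
  have "sim t (grafts [] (graft d a (graft (\<not> d) c (Leaf z))))"
    using sim_trans[OF t1(1) sim_join[OF t2 t1(2,3)]] by simp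
  from essential_pair[OF ess this] essential_dim[OF ess] show ?thesis
    by (simp add: assms(2) numeral_eq_Suc)
qed

text \<open>Degrees 1 to 4 contribute 2, 2, 2 and 1; degree 3 needs an argument of its own when the
  two outer letters are on the same side.\<close>

lemma bound_4:
  assumes ess: "essential t" and four: "nleaves t = 4"
  shows "dim (lin 0 S) + 7 \<le> dim (lin 4 S)"
proof -
  have ok: "ok t" using ess by (simp add: essential_def)
  have "2 \<le> nleaves t" using four by simp
  then obtain d a t1 where t1: "sim t (graft d a t1)" "ok (Leaf a)" "ok t1" "nleaves t = Suc (nleaves t1)"
    using comb_form_sized[OF ok] by blast
  then have "2 \<le> nleaves t1" using four by simp
  then obtain e c t2 where t2: "sim t1 (graft e c t2)" "ok (Leaf c)" "ok t2" "nleaves t1 = Suc (nleaves t2)"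
    using comb_form_sized[OF t1(3)] by blast
  have "nleaves t2 = 2" using four t1(4) t2(4) by simp
  then obtain y z where t3: "sim t2 (graft (\<not> e) y (Leaf z))" "ok (Leaf y)" "ok (Leaf z)"
    using comb_form_2[OF t2(3)] by metis
  have s1: "sim t1 (graft e c (graft (\<not> e) y (Leaf z)))"
    using sim_trans[OF t2(1) sim_join[OF t3(1) t2(2,3)]] .
  have s: "sim t (graft d a (graft e c (graft (\<not> e) y (Leaf z))))"
    using sim_trans[OF t1(1) sim_join[OF s1 t1(2,3)]] .
  have "sim t (grafts [(d, a)] (graft e c (graft (\<not> e) y (Leaf z))))" using s by simp
  note d12 = essential_pair[OF ess this]
  have "dim (lin 2 S) + 2 \<le> dim (lin 3 S)"
  proof (cases "e = d")
    case False
    then have "e = (\<not> d)" by auto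
    with s have "sim t (grafts [] (graft d a (graft (\<not> d) c (graft d y (Leaf z)))))" by simp
    from essential_pair(1)[OF ess this] show ?thesis by (simp add: numeral_eq_Suc)
  next
    case True
    let ?u = "graft d c (graft (\<not> d) y (Leaf z))" and ?v = "graft (\<not> d) y (graft d c (Leaf a))"
    have su: "sim t (graft d a ?u)" using s True by simp
    also have "sim \<dots> (join (\<not> d) (graft d c (Leaf a)) (graft (\<not> d) y (Leaf z)))"
      by (rule sim_fold) (use t1 t2 t3 in auto)
    also have "sim \<dots> (graft (\<not> d) z ?v)"
      by (rule sim_move) (use t1 t2 t3 in auto)
    finally have sv: "sim t (graft (\<not> d) z ?v)" .
    have eu: "essential (graft d a ?u)" and ev: "essential (graft (\<not> d) z ?v)"
      using essential_sim su sv ess by blast+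
    have au: "ok (graft d a ?v)" "lettered (graft d a ?v)" "ok ?u" "ok ?v"
      using eu ev by (auto simp: essential_def lettered_join)
    have units: "lettered ?u" "lettered ?v" "lettered (Leaf a)" "lettered (Leaf z)"
      using eu ev by (auto simp: essential_def lettered_join)
    show ?thesis
    proof (cases "val (graft d a ?v) \<in> low (graft d a ?v)")
      case False
      with au have "essential (graft d a ?v)" by (simp add: essential_def)
      moreover have "sim (graft d a ?v) (grafts [] (graft d a (graft (\<not> d) y (graft d c (Leaf a)))))" by simp
      ultimately have "dim (lin (nleaves (graft d c (Leaf a))) S) + 2 \<le> dim (lin (Suc (nleaves (graft d c (Leaf a)))) S)"
        by (rule essential_pair(1))
      then show ?thesis by (simp add: numeral_eq_Suc)
    next
      case True
      have L: "low (graft d a ?u) = lin 3 S" "low (graft d a ?v) = lin 3 S" "low (graft (\<not> d) z ?v) = lin 3 S"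
        using units by (simp_all add: low_def lettered_wt lettered_Leaf lettered_join numeral_3_eq_3)
      have lu: "val ?u \<in> lin 3 S" "val ?v \<in> lin 3 S"
        using val_lin[OF au(3)] val_lin[OF au(4)] lettered_wt[OF units(1)] lettered_wt[OF units(2)]
        by (simp_all add: numeral_3_eq_3)
      have a1: "fst a \<in> lin 1 S" "fst z \<in> lin 1 S" using t1(2) t3(3) units by (auto simp: ok_Leaf lettered_Leaf)
      have mu2: "bmult e (fst a) v \<in> lin 3 S" "bmult e (fst z) v \<in> lin 3 S" if "v \<in> lin 2 S" for e v
        using bmult_lin[OF a1(1) that] bmult_lin[OF a1(2) that] by (simp_all add: numeral_3_eq_3)
      \<comment> \<open>A triangular argument: multiplication by \<open>z\<close> detects
        \<open>?v\<close> modulo \<open>lin 2 S\<close>; multiplication by \<open>a\<close> sends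
        \<open>?v\<close> into \<open>lin 3 S\<close> but not \<open>?u\<close>.\<close>
      let ?W = "insert (val ?v) (lin 2 S)"
      have "dim (lin 2 S) + card {()} \<le> dim ?W"
        by (rule dim_step[where f = "\<lambda>_. val ?v" and L = "lin 3 S" and \<phi> = "\<lambda>_. bmult (\<not> d) (fst z)"])
          (use ev L mu2 subspace_lin in \<open>auto simp: bmult_add bmult_scale essential_def\<close>)
      moreover have "dim ?W + card {()} \<le> dim (lin 3 S)"
        by (rule dim_step[where f = "\<lambda>_. val ?u" and L = "lin 3 S" and \<phi> = "\<lambda>_. bmult d (fst a)"])
          (use eu True L mu2 lu subspace_lin lin_mono[of 2 3 S] in \<open>auto simp: bmult_add bmult_scale essential_def\<close>)
      ultimately show ?thesis by simp
    qed
  qed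
  with d12 essential_dim[OF ess] four show ?thesis by (simp add: numeral_eq_Suc)
qed

lemma essential_bound:
  assumes ess: "essential t" and k: "nleaves t = k" "3 \<le> k"
  shows "dim (lin 0 S) + (if k \<le> 5 then 2 * k - 1 else 3 * 2 ^ (k - 4) + 1) \<le> dim (lin k S)"
proof -
  consider "k = 3" | "k = 4" | "5 \<le> k" using k by linarith
  then show ?thesis
  proof cases
    case 3
    have pow: "(2::nat) ^ (k - 2) = 3 * 2 ^ (k - 4) + 2 ^ (k - 4)"
      using 3 by (auto simp: numeral_eq_Suc le_iff_add)
    let ?m = "size (cls t (Some True))" and ?n = "size (cls t (Some False))"
    have sum: "k = size (cls t None) + ?m + ?n" using k by (simp add: nleaves_def)
    have par: "even ?m \<longleftrightarrow> even ?n" by (rule cls_parity)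
    have "?m + ?n \<noteq> 0"
    proof
      assume "?m + ?n = 0"
      then obtain x where "t = Leaf x" using sides_empty[of t True] by auto
      with k show False by simp
    qed
    moreover have "?m + ?n \<noteq> 1" using par by presburger
    ultimately consider "?m + ?n = 2" | "3 \<le> ?m + ?n" by linarith
    then show ?thesis
    proof cases
      case 1
      from bound_two_sides[OF ess 1] 3 pow show ?thesis by (auto simp: k numeral_eq_Suc le_Suc_eq)
    next
      case 2
      \<comment> \<open>The smaller side class is chosen, because its size governs the loss in
        \<open>bound_many_sides\<close>.\<close>
      obtain b where b: "size (cls t (Some b)) \<le> size (cls t (Some (\<not> b)))"
        using that[of True] that[of False] by (cases "?m \<le> ?n") auto
      let ?b = "size (cls t (Some b))" and ?c = "size (cls t (Some (\<not> b)))"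
      have "3 \<le> ?b + ?c" using 2 by (cases b) auto
      note bd = bound_many_sides[OF ess b this]
      have "?b + ?c \<le> k" using nleaves_alt[of t b] k by simp
      with b have b2: "2 * ?b \<le> k" by simp
      show ?thesis
      proof (cases "k = 5")
        case True
        with b2 bd show ?thesis by (simp add: k)
      next
        case False
        \<comment> \<open>From \<open>2 * ?b \<le> k\<close> and \<open>k \<ge> 6\<close>; the loss
          is then at most a quarter of \<open>2 ^ (k - 2)\<close>.\<close>
        with b2 3 have "?b - 1 \<le> k - 4" by linarith
        then have "(2::nat) ^ (?b - 1) \<le> 2 ^ (k - 4)" by (rule power_increasing) simp
        then have "(if ?b \<le> 2 then 0 else 2 ^ (?b - 1)) \<le> (2::nat) ^ (k - 4)" by simp
        with bd have "dim (lin 0 S) + 2 ^ (k - 2) + 1 \<le> dim (lin k S) + 2 ^ (k - 4)"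
          unfolding k(1) by linarith
        with pow False 3 show ?thesis by simp
      qed
    qed
  qed (use bound_3[OF ess] bound_4[OF ess] k in auto)
qed

lemma word_tree: "word S j w \<Longrightarrow> 1 \<le> j \<Longrightarrow> \<exists>t. ok t \<and> lettered t \<and> val t = w \<and> nleaves t = j"
proof (induction rule: word.induct)
  case (letter s)
  then have "s \<in> lin 1 S" by (intro word_lin[OF word.letter]) auto
  then show ?case by (intro exI[of _ "Leaf (s, 1)"]) (auto simp: ok_Leaf lettered_Leaf)
next
  case (product m u n v)
  then obtain t t' where "ok t \<and> lettered t \<and> val t = u \<and> nleaves t = m"
    "ok t' \<and> lettered t' \<and> val t' = v \<and> nleaves t' = n" by blast
  then show ?case by (intro exI[of _ "Node t t'"]) (auto simp: ok_Node lettered_Node)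
qed auto

lemma ex_essential:
  assumes "lin (k - 1) S \<noteq> lin k S" "1 \<le> k"
  shows "\<exists>t. essential t \<and> nleaves t = k"
proof -
  have "\<not> words_upto S k \<subseteq> lin (k - 1) S"
    using assms(1) span_minimal[OF _ subspace_lin, of "words_upto S k"] lin_mono[of "k - 1" k S]
    by (auto simp: lin_def)
  then obtain j w where w: "j \<le> k" "word S j w" "w \<notin> lin (k - 1) S"
    by (auto simp: words_upto_def)
  then have "j = k" using word_lin[OF w(2), of "k - 1"] by linarith
  with w assms(2) obtain t where "ok t \<and> lettered t \<and> val t = w \<and> nleaves t = k"
    using word_tree[of k w] by blast
  then show ?thesis using w(3) by (auto simp: essential_def low_def lettered_wt)
qed

end

section \<open>From words to the length of the algebra\<close>

context fd_algebra
begin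

text \<open>A finite spanning set already lies in one \<open>lin k S\<close>, so the least such
  \<open>k\<close> is attained.\<close>

lemma set_length_props:
  assumes "generating S"
  shows "lin (set_length S) S = UNIV" and "1 \<le> set_length S \<Longrightarrow> lin (set_length S - 1) S \<noteq> UNIV"
proof -
  have inf: "lin_inf S = UNIV" using assms by (simp add: generating_def)
  obtain B where B: "finite B" "span B = UNIV" using finite_dim by blast
  have "\<forall>b. \<exists>k. b \<in> lin k S" using inf by (auto simp: lin_inf_def)
  then obtain f where f: "\<And>b. b \<in> lin (f b) S" by metis
  have "B \<subseteq> lin (Max (f ` B)) S"
  proof
    fix b assume "b \<in> B"
    then have "f b \<le> Max (f ` B)" using B(1) by simp
    then show "b \<in> lin (Max (f ` B)) S" using f lin_mono by blast
  qed
  then have "span B \<subseteq> lin (Max (f ` B)) S" by (rule span_minimal[OF _ subspace_lin])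
  then have "lin (Max (f ` B)) S = lin_inf S" using B inf by auto
  then show "lin (set_length S) S = UNIV" unfolding set_length_def inf[symmetric] by (rule LeastI)
  show "lin (set_length S - 1) S \<noteq> UNIV" if "1 \<le> set_length S"
    using not_less_Least[of "set_length S - 1" "\<lambda>k. lin k S = lin_inf S"] that inf
    by (auto simp: set_length_def)
qed

lemma set_length_bound:
  assumes "descendingly_flexible" "generating S" and k: "k = set_length S" "3 \<le> k"
    and nz: "(UNIV :: 'a set) \<noteq> {0}"
  shows "(if k \<le> 5 then 2 * k - 1 else 3 * 2 ^ (k - 4) + 1) \<le> dim UNIV - d0"
proof -
  interpret flexible_algebra scale mult S by unfold_locales (rule assms)
  have "lin (k - 1) S \<noteq> lin k S" using set_length_props[OF assms(2)] k by simp
  then obtain t where "essential t" "nleaves t = k" using ex_essential k(2) by fastforce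
  from essential_bound[OF this k(2)] have "dim (lin 0 S) + (if k \<le> 5 then 2 * k - 1 else 3 * 2 ^ (k - 4) + 1) \<le> dim UNIV"
    unfolding k(1) set_length_props(1)[OF assms(2)] .
  with d0_le_dim_lin_0[OF nz] show ?thesis by linarith
qed

text \<open>For \<open>Max\<close> to be meaningful the set must be nonempty, by the generating set
  \<open>UNIV\<close>, and finite, by the bound itself.\<close>

lemma alg_length_le:
  assumes "\<And>S. generating S \<Longrightarrow> set_length S \<le> M"
  shows "alg_length \<le> M"
proof -
  have "UNIV \<subseteq> lin 1 UNIV" using word_lin[OF word.letter, of _ UNIV 1] by auto
  then have "generating UNIV" by (auto simp: generating_def lin_inf_def)
  moreover have "finite {set_length S | S. generating S}"
    by (rule finite_subset[of _ "{..M}"]) (use assms in auto)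
  ultimately show ?thesis unfolding alg_length_def using assms by (intro Max.boundedI) auto
qed

end

theorem corollary5p18:
  fixes scale :: "'f::field \<Rightarrow> 'a::ab_group_add \<Rightarrow> 'a"
    and mult :: "'a \<Rightarrow> 'a \<Rightarrow> 'a"
    and n :: nat
  assumes "fd_algebra scale mult"
    and "fd_algebra.descendingly_flexible scale mult"
    and "n = vector_space.dim scale UNIV - fd_algebra.d0 mult"
  shows "(3 \<le> n \<and> n \<le> 10 \<longrightarrow>
            int (fd_algebra.alg_length scale mult) \<le> \<lceil>real n / 2\<rceil>) \<and>
         (11 \<le> n \<longrightarrow>
            int (fd_algebra.alg_length scale mult) \<le> \<lceil>log 2 (real n) + log 2 (8 / 3)\<rceil>)"
proof -
  interpret fd_algebra scale mult by (rule assms(1))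
  have bound: "(if k \<le> 5 then 2 * k - 1 else 3 * 2 ^ (k - 4) + 1) \<le> n"
    if "generating S" "set_length S = k" "3 \<le> k" "3 \<le> n" for S k
  proof -
    have "(UNIV :: 'a set) \<noteq> {0}"
    proof
      assume "(UNIV :: 'a set) = {0}"
      then have "dim (UNIV :: 'a set) = 0" using dim_singleton[of 0] by metis
      with assms(3) that show False by linarith
    qed
    from set_length_bound[OF assms(2) that(1) that(2)[symmetric] that(3) this] show ?thesis
      unfolding assms(3) .
  qed
  have "int alg_length \<le> \<lceil>real n / 2\<rceil>" if n: "3 \<le> n" "n \<le> 10"
  proof -
    have "set_length S \<le> nat \<lceil>real n / 2\<rceil>" if S: "generating S" for S
    proof (cases "3 \<le> set_length S")
      case True
      \<comment> \<open>Length 6 or more would force \<open>n \<ge> 13\<close>.\<close>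
      have "(2::nat) ^ 2 \<le> 2 ^ (set_length S - 4)" if "6 \<le> set_length S"
        using that by (intro power_increasing) auto
      with bound[OF S refl True n(1)] n have "2 * set_length S - 1 \<le> n" by (auto split: if_splits)
      with True show ?thesis by linarith
    next
      case False
      with n show ?thesis by linarith
    qed
    from alg_length_le[OF this] show ?thesis by linarith
  qed
  moreover have "int alg_length \<le> \<lceil>log 2 (real n) + log 2 (8 / 3)\<rceil>" if n: "11 \<le> n"
  proof -
    have eq: "log 2 (real n) + log 2 (8 / 3) = log 2 (8 * real n / 3)"
      using n log_mult_pos[of "real n" "8 / 3" 2] by (simp add: mult.commute)
    \<comment> \<open>The factor 16/3 is twice 8/3: halving gives the strict bound on
      \<open>k - 1\<close>, hence \<open>k\<close> is at most the ceiling.\<close>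
    have lt: "real k - 1 < log 2 (8 * real n / 3)" if "2 ^ k < 16 * real n / 3" for k :: nat
    proof -
      have "2 powr (real k - 1) = 2 ^ k / 2" by (simp add: powr_diff powr_realpow)
      with that n show ?thesis by (subst less_log_iff) auto
    qed
    have "set_length S \<le> nat \<lceil>log 2 (8 * real n / 3)\<rceil>" if S: "generating S" for S
    proof -
      let ?k = "set_length S"
      \<comment> \<open>For \<open>?k \<le> 5\<close> this is 32 < 16 * 11 / 3; otherwise it is
        \<open>3 * 2 ^ (?k - 4) < n\<close> multiplied by 16/3.\<close>
      have "2 ^ ?k < 16 * real n / 3"
      proof (cases "?k \<le> 5")
        case True
        then have "(2::real) ^ ?k \<le> 2 ^ 5" by (intro power_increasing) auto
        with n show ?thesis by simp
      next
        case False
        with bound[OF S refl] n have "3 * 2 ^ (?k - 4) + 1 \<le> n" by simp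
        then have "real (3 * 2 ^ (?k - 4) + 1) \<le> real n" by (rule of_nat_mono)
        moreover have "(2::real) ^ ?k = 2 ^ (?k - 4) * 2 ^ 4"
          using False power_add[of "2::real" "?k - 4" 4] by simp
        ultimately show ?thesis by simp
      qed
      from lt[OF this] show ?thesis by linarith
    qed
    from alg_length_le[OF this] have "alg_length \<le> nat \<lceil>log 2 (8 * real n / 3)\<rceil>" .
    moreover have "0 \<le> \<lceil>log 2 (8 * real n / 3)\<rceil>" using lt[of 0] n by simp
    ultimately show ?thesis unfolding eq by linarith
  qed
  ultimately show ?thesis by blast
qed

end
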